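(* Let $n\ge1$, let $a,b\in\mathbb{R}$ with $a<b$, and let $\Omega_0=\{x\in\mathbb{R}^{n+1}:a\le x_0\le b\}$. There is a constant $c(a,b)$ depending on $a,b$ such that for every $f\in L^2(\Omega_0,\mathcal{A})$ there exists $u\in L^2(\Omega_0,\mathcal{A})$ with $\overline{D}u=f$ in the weak sense and $$\int_{\Omega_0}|u|_0^2\,dx\le 2^{2n}c(a,b)\int_{\Omega_0}|f|_0^2\,dx.$$
   Context: Clifford algebra: $\mathcal{A}$ is the real $2^n$-dimensional unital associative algebra generated by $e_1,\dots,e_n$ with $e_0=1$ the unit, $e_ie_j+e_je_i=0$ for $1\le i\neq j\le n$ and $e_i^2=-1$ for $1\le i\le n$; its basis is $e_A=e_{h_1}\cdots e_{h_r}$ for $A=\{h_1<\dots<h_r\}\subset\{1,\dots,n\}$, with $e_\emptyset=e_0$. The norm on $\mathcal{A}$ is $|a|_0=\big(2^n\sum_A a_A^2\big)^{1/2}$ for $a=\sum_A a_Ae_A$, $a_A\in\mathbb{R}$. Operators: points of $\mathbb{R}^{n+1}$ are $x=(x_0,\dots,x_n)$; for $g=\sum_A g_Ae_A$, $\overline{D}g=\sum_{i=0}^n\sum_A e_ie_A\partial_{x_i}g_A$ and $g\overline{D}=\sum_{i=0}^n\sum_A e_Ae_i\partial_{x_i}g_A$. Spaces: $L^2(\Omega_0,\mathcal{A})$ is the set of $f=\sum_A f_Ae_A:\Omega_0\to\mathcal{A}$ with $\int_{\Omega_0}|f_A|^2dx<\infty$ for all $A$ (Lebesgue measure). For an open set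 $U$, $C_0^\infty(U,\mathcal{A})$ is the set of $\mathcal{A}$-valued functions all of whose components are real-valued, smooth and compactly supported in $U$. Weak solution: $\overline{D}u=f$ in the weak sense means $\int\alpha f\,dx=-\int(\alpha\overline{D})u\,dx$ for every $\alpha\in C_0^\infty(U,\mathcal{A})$, where $U=\{x\in\mathbb{R}^{n+1}:a<x_0<b\}$ is the interior of $\Omega_0$. *)

theory Defs
  imports "HOL-Analysis.Analysis"
begin

section \<open>The real Clifford algebras with \<open>e\<^sub>i\<^sup>2 = -1\<close>\<close>

text \<open>
  The algebras on \<open>n\<close> generators form an increasing chain in \<open>n\<close>. The type \<open>cliff\<close> is the
  union of this chain, so that one type serves every \<open>n\<close>; the \<open>2\<^sup>n\<close>-dimensional algebra itself is
  the subalgebra \<open>Cl n\<close> below. An element is represented by its coeficients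
  with respect to the basis \<open>e\<^sub>A\<close>.
\<close>

typedef cliff = "{a :: nat set \<Rightarrow> real. \<exists>n. \<forall>A. a A \<noteq> 0 \<longrightarrow> A \<subseteq> {1..n}}"
  morphisms coef Abs_cliff
  by (rule exI[of _ "\<lambda>_. 0"]) simp

setup_lifting type_definition_cliff

definition Cl :: "nat \<Rightarrow> cliff set" where
  "Cl n = {a. \<forall>A. coef a A \<noteq> 0 \<longrightarrow> A \<subseteq> {1..n}}"

lemma cliff_eqI: "(\<And>A. coef a A = coef b A) \<Longrightarrow> a = b"
  by (simp add: coef_inject[symmetric] fun_eq_iff)

lemma Cl_mono: "m \<le> n \<Longrightarrow> Cl m \<subseteq> Cl n"
  unfolding Cl_def by fastforce

lemma ex_Cl: "\<exists>n. a \<in> Cl n"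
  using coef[of a] unfolding Cl_def by auto

lemma ClD: "a \<in> Cl n \<Longrightarrow> \<not> A \<subseteq> {1..n} \<Longrightarrow> coef a A = 0"
  unfolding Cl_def by auto

lemma ex_Cl2: obtains n where "a \<in> Cl n" "b \<in> Cl n"
proof -
  obtain k l where "a \<in> Cl k" "b \<in> Cl l" using ex_Cl by metis
  then have "a \<in> Cl (max k l)" "b \<in> Cl (max k l)"
    using Cl_mono[of k "max k l"] Cl_mono[of l "max k l"] by auto
  then show ?thesis using that by blast
qed

text \<open>
  The sign in \<open>e\<^sub>A e\<^sub>B = \<plusminus>e\<^sub>C\<close>, where \<open>C\<close> is the symmetric difference of \<open>A\<close> and \<open>B\<close>: every pair
  \<open>i > j\<close> costs one transposition, every pair \<open>i = j\<close> one relation \<open>e\<^sub>i\<^sup>2 = -1\<close>.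
\<close>

definition cliff_sign :: "nat set \<Rightarrow> nat set \<Rightarrow> real" where
  "cliff_sign A B = (\<Prod>i\<in>A. \<Prod>j\<in>B. if j \<le> i then -1 else 1)"

lemma prod_sym_diff:
  fixes h :: "'a \<Rightarrow> real"
  assumes "finite A" "finite B" "\<And>x. h x * h x = 1"
  shows "prod h (sym_diff A B) = prod h A * prod h B"
proof -
  have 1: "prod h (sym_diff A B) = prod h (A - B) * prod h (B - A)"
    by (rule prod.union_disjoint) (use assms in auto)
  have 2: "prod h A = prod h (A - B) * prod h (A \<inter> B)"
    by (subst prod.union_disjoint[symmetric]) (use assms in \<open>auto intro!: prod.cong\<close>)
  have 3: "prod h B = prod h (B - A) * prod h (A \<inter> B)"
    by (subst prod.union_disjoint[symmetric]) (use assms in \<open>auto intro!: prod.cong\<close>)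
  have 4: "prod h (A \<inter> B) * prod h (A \<inter> B) = 1"
    by (simp add: prod.distrib[symmetric] assms)
  have "prod h A * prod h B
      = prod h (A - B) * prod h (B - A) * (prod h (A \<inter> B) * prod h (A \<inter> B))"
    unfolding 2 3 by (simp only: mult_ac)
  with 1 4 show ?thesis by simp
qed

lemma cliff_sign_sym_diff_left:
  assumes "finite A" "finite B"
  shows "cliff_sign (sym_diff A B) C = cliff_sign A C * cliff_sign B C"
  unfolding cliff_sign_def
  by (rule prod_sym_diff) (use assms in \<open>auto simp: prod.distrib[symmetric] intro!: prod.neutral\<close>)

lemma cliff_sign_sym_diff_right:
  assumes "finite A" "finite B"
  shows "cliff_sign C (sym_diff A B) = cliff_sign C A * cliff_sign C B"
  unfolding cliff_sign_def
  by (simp add: prod_sym_diff[OF assms] prod.distrib)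

lemma sym_diff_assoc: "sym_diff (sym_diff A B) C = sym_diff A (sym_diff B C)"
  by auto

lemma sym_diff_cancel [simp]: "sym_diff A (sym_diff A B) = B"
  by auto

lemma sym_diff_eq_iff: "sym_diff A X = B \<longleftrightarrow> X = sym_diff A B"
  using sym_diff_cancel by metis

lemma sum_sym_diff_reindex:
  assumes "A \<subseteq> S"
  shows "(\<Sum>B\<in>Pow S. f (sym_diff A B)) = (\<Sum>B\<in>Pow S. f B)"
  by (rule sum.reindex_bij_witness[of _ "\<lambda>B. sym_diff A B" "\<lambda>B. sym_diff A B"])
     (use assms in auto)

instantiation cliff :: real_algebra_1
begin

lift_definition zero_cliff :: cliff is "\<lambda>_. 0" by simp

lift_definition one_cliff :: cliff is "\<lambda>A. if A = {} then 1 else 0"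
  by (rule exI[of _ 0]) simp

lift_definition plus_cliff :: "cliff \<Rightarrow> cliff \<Rightarrow> cliff" is "\<lambda>a b A. a A + b A"
proof -
  fix a b :: "nat set \<Rightarrow> real"
  assume "\<exists>n. \<forall>A. a A \<noteq> 0 \<longrightarrow> A \<subseteq> {1..n}" "\<exists>n. \<forall>A. b A \<noteq> 0 \<longrightarrow> A \<subseteq> {1..n}"
  then obtain k l where "\<forall>A. a A \<noteq> 0 \<longrightarrow> A \<subseteq> {1..k}" "\<forall>A. b A \<noteq> 0 \<longrightarrow> A \<subseteq> {1..l}"
    by (elim exE)
  then have kl: "\<And>A. a A \<noteq> 0 \<Longrightarrow> A \<subseteq> {1..k}" "\<And>A. b A \<noteq> 0 \<Longrightarrow> A \<subseteq> {1..l}" by simp_all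
  have "A \<subseteq> {1..max k l}" if "a A + b A \<noteq> 0" for A
  proof -
    from that have "a A \<noteq> 0 \<or> b A \<noteq> 0" by auto
    then show ?thesis using kl[of A] by fastforce
  qed
  then show "\<exists>n. \<forall>A. a A + b A \<noteq> 0 \<longrightarrow> A \<subseteq> {1..n}" by blast
qed

lift_definition uminus_cliff :: "cliff \<Rightarrow> cliff" is "\<lambda>a A. - a A" by simp

definition minus_cliff :: "cliff \<Rightarrow> cliff \<Rightarrow> cliff" where
  "minus_cliff a b = a + - b"

lift_definition scaleR_cliff :: "real \<Rightarrow> cliff \<Rightarrow> cliff" is "\<lambda>r a A. r * a A" by auto

lift_definition times_cliff :: "cliff \<Rightarrow> cliff \<Rightarrow> cliff" is
  "\<lambda>a b C. \<Sum>A | a A \<noteq> 0. cliff_sign A (sym_diff A C) * (a A * b (sym_diff A C))"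
proof -
  fix a b :: "nat set \<Rightarrow> real"
  assume "\<exists>n. \<forall>A. a A \<noteq> 0 \<longrightarrow> A \<subseteq> {1..n}" "\<exists>n. \<forall>A. b A \<noteq> 0 \<longrightarrow> A \<subseteq> {1..n}"
  then obtain k l where "\<forall>A. a A \<noteq> 0 \<longrightarrow> A \<subseteq> {1..k}" "\<forall>A. b A \<noteq> 0 \<longrightarrow> A \<subseteq> {1..l}"
    by (elim exE)
  then have kl: "\<And>A. a A \<noteq> 0 \<Longrightarrow> A \<subseteq> {1..k}" "\<And>A. b A \<noteq> 0 \<Longrightarrow> A \<subseteq> {1..l}" by simp_all
  have "C \<subseteq> {1..max k l}"
    if nz: "(\<Sum>A | a A \<noteq> 0. cliff_sign A (sym_diff A C) * (a A * b (sym_diff A C))) \<noteq> 0" for C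
  proof -
    obtain A where "A \<in> {A. a A \<noteq> 0}"
        "cliff_sign A (sym_diff A C) * (a A * b (sym_diff A C)) \<noteq> 0"
      using nz by (rule sum.not_neutral_contains_not_neutral)
    then have "a A \<noteq> 0" "b (sym_diff A C) \<noteq> 0" by auto
    then have "A \<subseteq> {1..k}" "sym_diff A C \<subseteq> {1..l}" using kl by blast+
    then show ?thesis by fastforce
  qed
  then show "\<exists>n. \<forall>C. (\<Sum>A | a A \<noteq> 0. cliff_sign A (sym_diff A C) * (a A * b (sym_diff A C))) \<noteq> 0
      \<longrightarrow> C \<subseteq> {1..n}" by blast
qed

lemma coef_simps [simp]:
  "coef 0 A = 0" "coef 1 A = (if A = {} then 1 else 0)" "coef (a + b) A = coef a A + coef b A"
  "coef (- a) A = - coef a A" "coef (a - b) A = coef a A - coef b A"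
  "coef (r *\<^sub>R a) A = r * coef a A"
  by (simp_all add: minus_cliff_def zero_cliff.rep_eq one_cliff.rep_eq plus_cliff.rep_eq
      uminus_cliff.rep_eq scaleR_cliff.rep_eq)

lemma coef_mult:
  assumes "a \<in> Cl n"
  shows "coef (a * b) C
    = (\<Sum>A\<in>Pow {1..n}. cliff_sign A (sym_diff A C) * (coef a A * coef b (sym_diff A C)))"
  unfolding times_cliff.rep_eq
  by (rule sum.mono_neutral_left) (use assms in \<open>auto simp: Cl_def\<close>)

lemma Cl_add:
  assumes "a \<in> Cl n" "b \<in> Cl n"
  shows "a + b \<in> Cl n"
proof -
  have "A \<subseteq> {1..n}" if "coef (a + b) A \<noteq> 0" for A
  proof -
    from that have "coef a A \<noteq> 0 \<or> coef b A \<noteq> 0" by auto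
    then show ?thesis using assms unfolding Cl_def by blast
  qed
  then show ?thesis unfolding Cl_def by blast
qed

lemma Cl_mult:
  assumes a: "a \<in> Cl n" and b: "b \<in> Cl n"
  shows "a * b \<in> Cl n"
proof -
  have "C \<subseteq> {1..n}" if nz: "coef (a * b) C \<noteq> 0" for C
  proof -
    obtain A where "A \<in> Pow {1..n}"
        "cliff_sign A (sym_diff A C) * (coef a A * coef b (sym_diff A C)) \<noteq> 0"
      using nz unfolding coef_mult[OF a] by (rule sum.not_neutral_contains_not_neutral)
    then have "A \<subseteq> {1..n}" "coef b (sym_diff A C) \<noteq> 0" by auto
    with b have "A \<subseteq> {1..n}" "sym_diff A C \<subseteq> {1..n}" unfolding Cl_def by blast+
    then show ?thesis by blast
  qed
  then show ?thesis unfolding Cl_def by blast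
qed

lemma cliff_mult_assoc:
  fixes a b c :: cliff
  shows "a * b * c = a * (b * c)"
proof -
  obtain n where a: "a \<in> Cl n" and b: "b \<in> Cl n" and c: "c \<in> Cl n"
  proof -
    obtain k where "a \<in> Cl k" "b \<in> Cl k" by (rule ex_Cl2)
    moreover obtain l where "c \<in> Cl l" using ex_Cl by blast
    ultimately show ?thesis
      using that[of "max k l"] Cl_mono[of k "max k l"] Cl_mono[of l "max k l"] by auto
  qed
  show ?thesis
  proof (rule cliff_eqI)
    fix D
    show "coef (a * b * c) D = coef (a * (b * c)) D"
    proof (cases "D \<subseteq> {1..n}")
      case False
      then show ?thesis using Cl_mult a b c by (metis ClD)
    next
      case D: True
      let ?P = "Pow {1..n}"
      have "coef (a * b * c) D = (\<Sum>E\<in>?P. \<Sum>A\<in>?P. cliff_sign E (sym_diff E D) * cliff_sign A (sym_diff A E)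
          * (coef a A * coef b (sym_diff A E) * coef c (sym_diff E D)))"
        unfolding coef_mult[OF Cl_mult[OF a b]] coef_mult[OF a]
        by (simp add: sum_distrib_left sum_distrib_right mult_ac)
      also have "\<dots> = (\<Sum>A\<in>?P. \<Sum>E\<in>?P. cliff_sign E (sym_diff E D) * cliff_sign A (sym_diff A E)
          * (coef a A * coef b (sym_diff A E) * coef c (sym_diff E D)))"
        by (rule sum.swap)
      also have "\<dots> = (\<Sum>A\<in>?P. \<Sum>B\<in>?P. cliff_sign A (sym_diff A D) * cliff_sign B (sym_diff B (sym_diff A D))
          * (coef a A * coef b B * coef c (sym_diff B (sym_diff A D))))"
      proof (rule sum.cong[OF refl])
        fix A assume A: "A \<in> ?P"
        show "(\<Sum>E\<in>?P. cliff_sign E (sym_diff E D) * cliff_sign A (sym_diff A E)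
            * (coef a A * coef b (sym_diff A E) * coef c (sym_diff E D)))
          = (\<Sum>B\<in>?P. cliff_sign A (sym_diff A D) * cliff_sign B (sym_diff B (sym_diff A D))
            * (coef a A * coef b B * coef c (sym_diff B (sym_diff A D))))" (is "_ = (\<Sum>B\<in>_. ?g B)")
        proof (subst sum_sym_diff_reindex[of A, where f = ?g, symmetric])
          show "A \<subseteq> {1..n}" using A by simp
          show "(\<Sum>E\<in>?P. cliff_sign E (sym_diff E D) * cliff_sign A (sym_diff A E)
            * (coef a A * coef b (sym_diff A E) * coef c (sym_diff E D))) = (\<Sum>B\<in>?P. ?g (sym_diff A B))"
          proof (rule sum.cong[OF refl])
            fix E assume E: "E \<in> ?P"
            define B where "B = sym_diff A E"
            define X where "X = sym_diff E D"
            have fin: "finite A" "finite B" "finite X"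
              using A E D unfolding B_def X_def by (auto intro: finite_subset)
            have e: "E = sym_diff A B" and x: "sym_diff B (sym_diff A D) = X"
              and d: "sym_diff A D = sym_diff B X"
              unfolding B_def X_def by auto
            have "cliff_sign E X * cliff_sign A B = cliff_sign A (sym_diff A D) * cliff_sign B X"
              unfolding d cliff_sign_sym_diff_right[OF fin(2,3)]
              unfolding e cliff_sign_sym_diff_left[OF fin(1,2)] by simp
            then show "cliff_sign E (sym_diff E D) * cliff_sign A (sym_diff A E)
              * (coef a A * coef b (sym_diff A E) * coef c (sym_diff E D)) = ?g (sym_diff A E)"
              unfolding B_def[symmetric] x unfolding X_def[symmetric] by simp
          qed
        qed
      qed
      also have "\<dots> = coef (a * (b * c)) D"
        unfolding coef_mult[OF a] coef_mult[OF b]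
        by (simp add: sum_distrib_left sum_distrib_right mult_ac)
      finally show ?thesis .
    qed
  qed
qed

instance
proof
  fix a b c :: cliff and r s :: real
  show "a + b + c = a + (b + c)" "a + b = b + a" "0 + a = a" "- a + a = 0" "a - b = a + - b"
    "r *\<^sub>R (a + b) = r *\<^sub>R a + r *\<^sub>R b" "(r + s) *\<^sub>R a = r *\<^sub>R a + s *\<^sub>R a"
    "r *\<^sub>R s *\<^sub>R a = (r * s) *\<^sub>R a" "1 *\<^sub>R a = a"
    by (rule cliff_eqI; simp add: algebra_simps)+
  have "coef (0 :: cliff) {} \<noteq> coef 1 {}" by simp
  then show "(0 :: cliff) \<noteq> 1" by metis
  show "a * b * c = a * (b * c)" by (rule cliff_mult_assoc)
  have one: "1 \<in> Cl 0" by (auto simp: Cl_def)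
  show "1 * a = a"
    by (rule cliff_eqI) (simp add: coef_mult[OF one] cliff_sign_def)
  obtain n where a: "a \<in> Cl n" using ex_Cl by blast
  show "a * 1 = a"
  proof (rule cliff_eqI)
    fix C
    have "coef (a * 1) C = (\<Sum>A\<in>Pow {1..n}. if A = C then coef a A else 0)"
      unfolding coef_mult[OF a] by (intro sum.cong) (auto simp: cliff_sign_def)
    also have "\<dots> = coef a C" using a by (auto simp: Cl_def sum.delta)
    finally show "coef (a * 1) C = coef a C" .
  qed
  show "a * (b + c) = a * b + a * c"
    by (rule cliff_eqI) (simp add: coef_mult[OF a] sum.distrib[symmetric] algebra_simps)
  show "a * (r *\<^sub>R b) = r *\<^sub>R (a * b)"
    by (rule cliff_eqI) (simp add: coef_mult[OF a] sum_distrib_left mult_ac)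
  have ra: "r *\<^sub>R a \<in> Cl n" using a by (auto simp: Cl_def)
  show "r *\<^sub>R a * b = r *\<^sub>R (a * b)"
    by (rule cliff_eqI) (simp add: coef_mult[OF a] coef_mult[OF ra] sum_distrib_left mult_ac)
  obtain m where ab: "a \<in> Cl m" "b \<in> Cl m" by (rule ex_Cl2)
  have sum: "a + b \<in> Cl m" using ab by (rule Cl_add)
  show "(a + b) * c = a * c + b * c"
    by (rule cliff_eqI)
       (simp add: coef_mult[OF ab(1)] coef_mult[OF ab(2)] coef_mult[OF sum] sum.distrib[symmetric]
         algebra_simps)
qed

end

lemma Cl_one: "1 \<in> Cl n"
  by (auto simp: Cl_def)

lemma Cl_scaleR: "a \<in> Cl n \<Longrightarrow> r *\<^sub>R a \<in> Cl n"
  by (auto simp: Cl_def)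

text \<open>The generators, with \<open>gen 0 = e\<^sub>0 = 1\<close>, and the basis elements \<open>e\<^sub>A\<close>.\<close>

lift_definition gen :: "nat \<Rightarrow> cliff" is
  "\<lambda>i A. if A = (if i = 0 then {} else {i}) then 1 else 0"
proof -
  fix i :: nat
  show "\<exists>n. \<forall>A. (if A = (if i = 0 then {} else {i}) then 1 else 0 :: real) \<noteq> 0 \<longrightarrow> A \<subseteq> {1..n}"
    by (rule exI[of _ i]) auto
qed

definition blade :: "nat set \<Rightarrow> cliff" where
  "blade A = prod_list (map gen (sorted_list_of_set A))"

lemma gen_0: "gen 0 = 1"
  by (rule cliff_eqI) (simp add: gen.rep_eq)

lemma gen_in_Cl: "i \<le> n \<Longrightarrow> gen i \<in> Cl n"
  by (auto simp: Cl_def gen.rep_eq split: if_splits)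

lemma coef_gen_mult:
  assumes "1 \<le> i"
  shows "coef (gen i * b) C = cliff_sign {i} (sym_diff {i} C) * coef b (sym_diff {i} C)"
proof -
  have "coef (gen i * b) C = (\<Sum>A\<in>Pow {1..i}. if A = {i}
      then cliff_sign {i} (sym_diff {i} C) * coef b (sym_diff {i} C) else 0)"
    unfolding coef_mult[OF gen_in_Cl[OF order.refl]]
    by (intro sum.cong) (use assms in \<open>auto simp: gen.rep_eq\<close>)
  also have "\<dots> = cliff_sign {i} (sym_diff {i} C) * coef b (sym_diff {i} C)"
    using assms by (subst sum.delta) auto
  finally show ?thesis .
qed

lemma gen_square:
  assumes "1 \<le> i"
  shows "gen i * gen i = - 1"
proof (rule cliff_eqI)
  fix C
  have "sym_diff {i} C = {i} \<longleftrightarrow> C = {}" by auto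
  then show "coef (gen i * gen i) C = coef (- 1) C"
    using assms by (simp add: coef_gen_mult gen.rep_eq cliff_sign_def)
qed

lemma gen_anticommute:
  assumes "1 \<le> i" "1 \<le> j" "i \<noteq> j"
  shows "gen i * gen j + gen j * gen i = 0"
proof (rule cliff_eqI)
  fix C
  have d1: "sym_diff {i} {j} = {i, j}" and d2: "sym_diff {j} {i} = {i, j}" using assms by auto
  have iff: "sym_diff {i} C = {j} \<longleftrightarrow> C = {i, j}" "sym_diff {j} C = {i} \<longleftrightarrow> C = {i, j}"
    unfolding sym_diff_eq_iff d1 d2 by (rule refl)+
  have diff: "sym_diff {i} {i, j} = {j}" "sym_diff {j} {i, j} = {i}"
    by (rule sym_diff_eq_iff[THEN iffD2, OF d1[symmetric]] sym_diff_eq_iff[THEN iffD2, OF d2[symmetric]])+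
  show "coef (gen i * gen j + gen j * gen i) C = coef 0 C"
  proof (cases "C = {i, j}")
    case True
    have "cliff_sign {i} {j} + cliff_sign {j} {i} = 0"
      using assms by (auto simp: cliff_sign_def)
    then show ?thesis using assms
      unfolding True coef_simps coef_gen_mult[OF assms(1)] coef_gen_mult[OF assms(2)] diff
      by (simp add: gen.rep_eq)
  next
    case False
    then have "coef (gen j) (sym_diff {i} C) = 0" "coef (gen i) (sym_diff {j} C) = 0"
      using assms iff by (simp_all add: gen.rep_eq del: Un_iff)
    then show ?thesis using assms by (simp only: coef_simps coef_gen_mult)
  qed
qed

lemma coef_blade:
  assumes "finite A" "0 \<notin> A"
  shows "coef (blade A) C = (if C = A then 1 else 0)"
proof -
  have "coef (prod_list (map gen xs)) C = (if C = set xs then 1 else 0)"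
    if "sorted xs" "distinct xs" "0 \<notin> set xs" for xs
    using that
  proof (induction xs arbitrary: C)
    case Nil
    then show ?case by simp
  next
    case (Cons i xs)
    have less: "i < j" if "j \<in> set xs" for j
    proof -
      have "i \<le> j" using Cons.prems(1) that by simp
      moreover have "i \<noteq> j" using Cons.prems(2) that by auto
      ultimately show ?thesis by simp
    qed
    have i: "1 \<le> i" "i \<notin> set xs" using Cons.prems by (auto simp: Suc_le_eq)
    have d: "sym_diff {i} (set xs) = set (i # xs)" using i by auto
    have iff: "sym_diff {i} C = set xs \<longleftrightarrow> C = set (i # xs)"
      unfolding sym_diff_eq_iff d by (rule refl)
    have sign: "cliff_sign {i} (set xs) = 1"
      unfolding cliff_sign_def using less by (simp add: not_le[symmetric] prod.neutral)
    have IH: "coef (prod_list (map gen xs)) B = (if B = set xs then 1 else 0)" for B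
      using Cons by simp
    have "coef (prod_list (map gen (i # xs))) C
        = cliff_sign {i} (sym_diff {i} C) * (if sym_diff {i} C = set xs then 1 else 0)"
      unfolding list.map prod_list.Cons coef_gen_mult[OF i(1)] IH by (rule refl)
    then show ?case unfolding iff[symmetric]
      by (cases "sym_diff {i} C = set xs") (simp_all only: sign mult_1_right mult_zero_right if_True if_False)
  qed
  from this[of "sorted_list_of_set A"] show ?thesis using assms by (simp add: blade_def)
qed

lemma coef_sum: "coef (sum f S) A = (\<Sum>x\<in>S. coef (f x) A)"
  by (induction S rule: infinite_finite_induct) auto

lemma blade_expansion:
  assumes "a \<in> Cl n"
  shows "a = (\<Sum>A\<in>Pow {1..n}. coef a A *\<^sub>R blade A)"
proof (rule cliff_eqI)
  fix C
  have "coef (\<Sum>A\<in>Pow {1..n}. coef a A *\<^sub>R blade A) C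
      = (\<Sum>A\<in>Pow {1..n}. if A = C then coef a A else 0)"
    unfolding coef_sum
  proof (rule sum.cong[OF refl])
    fix A assume "A \<in> Pow {1..n}"
    then have "finite A" "0 \<notin> A" by (auto intro: finite_subset)
    then show "coef (coef a A *\<^sub>R blade A) C = (if A = C then coef a A else 0)"
      by (simp add: coef_blade)
  qed
  also have "\<dots> = coef a C" using assms by (auto simp: Cl_def sum.delta)
  finally show "coef a C = coef (\<Sum>A\<in>Pow {1..n}. coef a A *\<^sub>R blade A) C" by simp
qed

definition norm0 :: "nat \<Rightarrow> cliff \<Rightarrow> real" where
  "norm0 n a = sqrt (2 ^ n * (\<Sum>A\<in>Pow {1..n}. (coef a A)\<^sup>2))"


section \<open>Function spaces on \<open>\<real>\<^sup>n\<^sup>+\<^sup>1\<close>\<close>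

text \<open>
  Since \<open>n\<close> varies, points \<open>(x\<^sub>0, \<dots>, x\<^sub>n)\<close> are functions on \<open>{..n}\<close> (extensional outside), and
  Lebesgue measure is the completed product of the one-dimensional ones. The topology of \<open>nat \<Rightarrow> real\<close>
  is the product topology, which induces the Euclidean one on the closed set \<open>Rn1 n\<close>.
\<close>

definition Rn1 :: "nat \<Rightarrow> (nat \<Rightarrow> real) set" where
  "Rn1 n = (\<Pi>\<^sub>E i\<in>{..n}. UNIV)"

definition leb :: "nat \<Rightarrow> (nat \<Rightarrow> real) measure" where
  "leb n = completion (\<Pi>\<^sub>M i\<in>{..n}. lborel)"

definition Omega0 :: "nat \<Rightarrow> real \<Rightarrow> real \<Rightarrow> (nat \<Rightarrow> real) set" where
  "Omega0 n a b = {x \<in> Rn1 n. a \<le> x 0 \<and> x 0 \<le> b}"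

definition Omega0_int :: "nat \<Rightarrow> real \<Rightarrow> real \<Rightarrow> (nat \<Rightarrow> real) set" where
  "Omega0_int n a b = {x \<in> Rn1 n. a < x 0 \<and> x 0 < b}"

definition L2 :: "nat \<Rightarrow> (nat \<Rightarrow> real) set \<Rightarrow> ((nat \<Rightarrow> real) \<Rightarrow> cliff) set" where
  "L2 n S = {f. (\<forall>x\<in>S. f x \<in> Cl n) \<and>
     (\<forall>A\<in>Pow {1..n}. set_borel_measurable (leb n) S (\<lambda>x. coef (f x) A) \<and>
        set_integrable (leb n) S (\<lambda>x. (coef (f x) A)\<^sup>2))}"

definition partial :: "nat \<Rightarrow> ((nat \<Rightarrow> real) \<Rightarrow> real) \<Rightarrow> (nat \<Rightarrow> real) \<Rightarrow> real" where
  "partial i g x = deriv (\<lambda>t. g (x(i := t))) (x i)"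

definition smooth :: "nat \<Rightarrow> ((nat \<Rightarrow> real) \<Rightarrow> real) \<Rightarrow> bool" where
  "smooth n g \<longleftrightarrow> (\<forall>is. set is \<subseteq> {..n} \<longrightarrow>
     continuous_on (Rn1 n) (foldr partial is g) \<and>
     (\<forall>i\<le>n. \<forall>x\<in>Rn1 n. (\<lambda>t. foldr partial is g (x(i := t))) differentiable (at (x i))))"

text \<open>
  Smooth functions with compact support in the open set \<open>U\<close>, extended by \<open>0\<close> to all of \<open>Rn1 n\<close>.
\<close>

definition C0_infty :: "nat \<Rightarrow> (nat \<Rightarrow> real) set \<Rightarrow> ((nat \<Rightarrow> real) \<Rightarrow> cliff) set" where
  "C0_infty n U = {\<alpha>. (\<forall>x\<in>Rn1 n. \<alpha> x \<in> Cl n) \<and>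
     (\<forall>A\<in>Pow {1..n}. smooth n (\<lambda>x. coef (\<alpha> x) A) \<and>
        compact (closure {x \<in> Rn1 n. coef (\<alpha> x) A \<noteq> 0}) \<and>
        closure {x \<in> Rn1 n. coef (\<alpha> x) A \<noteq> 0} \<subseteq> U)}"

text \<open>The operator \<open>g \<mapsto> gD\<close> (with \<open>D\<close> barred) acting from the right.\<close>

definition Dbar_right :: "nat \<Rightarrow> ((nat \<Rightarrow> real) \<Rightarrow> cliff) \<Rightarrow> (nat \<Rightarrow> real) \<Rightarrow> cliff" where
  "Dbar_right n g x =
     (\<Sum>i\<in>{..n}. \<Sum>A\<in>Pow {1..n}. partial i (\<lambda>y. coef (g y) A) x *\<^sub>R (blade A * gen i))"

definition cliff_integral :: "nat \<Rightarrow> (nat \<Rightarrow> real) set \<Rightarrow> ((nat \<Rightarrow> real) \<Rightarrow> cliff) \<Rightarrow> cliff" where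
  "cliff_integral n S g = (\<Sum>A\<in>Pow {1..n}. (LINT x:S|leb n. coef (g x) A) *\<^sub>R blade A)"

definition weak_solution ::
  "nat \<Rightarrow> (nat \<Rightarrow> real) set \<Rightarrow> ((nat \<Rightarrow> real) \<Rightarrow> cliff) \<Rightarrow> ((nat \<Rightarrow> real) \<Rightarrow> cliff) \<Rightarrow> bool" where
  "weak_solution n U u f \<longleftrightarrow> (\<forall>\<alpha>\<in>C0_infty n U.
     cliff_integral n U (\<lambda>x. \<alpha> x * f x) = - cliff_integral n U (\<lambda>x. Dbar_right n \<alpha> x * u x))"

end

theory Submission
  imports Defs
begin

text \<open>
  On test functions the operator \<open>\<alpha> \<mapsto> \<alpha>D\<close> (with \<open>D\<close> barred) is bounded below. Right multiplication by
  \<open>e\<^sub>i\<close> is orthogonal, and the products of \<open>\<partial>\<^sub>i\<alpha> e\<^sub>i\<close> and \<open>\<partial>\<^sub>j\<alpha> e\<^sub>j\<close> with \<open>i \<noteq> j\<close> cancel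
  in pairs after integration, so \<open>\<parallel>\<alpha>D\<parallel>\<^sup>2 = \<Sum>\<^sub>i \<parallel>\<partial>\<^sub>i\<alpha>\<parallel>\<^sup>2 \<ge> \<parallel>\<partial>\<^sub>0\<alpha>\<parallel>\<^sup>2\<close>. The support lies in a strip of
  width \<open>b - a\<close>, hence a one-dimensional Poincare inequality gives
  \<open>\<parallel>\<alpha>\<parallel>\<^sup>2 \<le> 4 (b - a)\<^sup>2 \<parallel>\<alpha>D\<parallel>\<^sup>2\<close>. Therefore the scalar part of \<open>\<integral> \<alpha> f\<close> is a bounded linear functional
  of \<open>\<alpha>D\<close>, and its Riesz representation yields \<open>u\<close>. The other components of the weak equation follow on
  replacing \<open>\<alpha>\<close> by \<open>e\<^sub>C \<alpha>\<close>.
\<close>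

section \<open>Riesz representation in \<open>L\<^sup>2\<close>\<close>

text \<open>The weak equation fixes the pairing of \<open>u\<close> only with the functions
  \<open>\<alpha>D\<close>; the lower bound makes this pairing well defined and bounded. These
  functions need not form a closed subspace, so the representing element has to be sought in the
  closure, as an L2 limit. This is why completeness is part of the argument. The constant must be
  independent of \<open>n\<close>, because \<open>c\<close> depends on \<open>a\<close> and
  \<open>b\<close> alone. An exact identity for the norm of \<open>\<alpha>D\<close> achieves this:
  the cross terms vanish instead of being estimated, and only \<open>x\<^sub>0\<close>, the one
  direction in which all supports are uniformly bounded, enters the constant. The scalar part of a
  product is not the Euclidean pairing of coordinates: in coordinate \<open>A\<close> the two differ
  by the sign of the square of \<open>e\<^sub>A\<close>. So \<open>f\<close> is twisted by these
  signs before the Riesz argument, and \<open>u\<close> after it. Passing to the scalar part loses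
  nothing, since the operator multiplies from the right and thus commutes with left multiplication
  by \<open>e\<^sub>C\<close>.\<close>

definition square_integrable :: "'a measure \<Rightarrow> ('a \<Rightarrow> real) \<Rightarrow> bool" where
  "square_integrable M f \<longleftrightarrow> f \<in> borel_measurable M \<and> integrable M (\<lambda>x. (f x)\<^sup>2)"

lemma square_integrable_mult:
  assumes "square_integrable M f" "square_integrable M g"
  shows "integrable M (\<lambda>x. f x * g x)"
proof (rule Bochner_Integration.integrable_bound)
  show "integrable M (\<lambda>x. (f x)\<^sup>2 + (g x)\<^sup>2)"
    using assms by (auto simp: square_integrable_def)
  show "(\<lambda>x. f x * g x) \<in> borel_measurable M"
    using assms by (auto simp: square_integrable_def)
  have "\<bar>f x * g x\<bar> \<le> (f x)\<^sup>2 + (g x)\<^sup>2" for x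
  proof -
    have "0 \<le> (\<bar>f x\<bar> - \<bar>g x\<bar>)\<^sup>2" by simp
    then have "2 * (\<bar>f x\<bar> * \<bar>g x\<bar>) \<le> (f x)\<^sup>2 + (g x)\<^sup>2" by (simp add: power2_diff)
    moreover have "0 \<le> \<bar>f x\<bar> * \<bar>g x\<bar>" by simp
    ultimately show ?thesis by (simp only: abs_mult)
  qed
  then show "AE x in M. norm (f x * g x) \<le> norm ((f x)\<^sup>2 + (g x)\<^sup>2)" by simp
qed

lemma square_integrable_lincomb:
  assumes "square_integrable M f" "square_integrable M g"
  shows "square_integrable M (\<lambda>x. s * f x + t * g x)"
proof -
  have "integrable M (\<lambda>x. s\<^sup>2 * (f x)\<^sup>2 + 2 * s * t * (f x * g x) + t\<^sup>2 * (g x)\<^sup>2)"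
    using assms square_integrable_mult[OF assms] by (auto simp: square_integrable_def)
  also have "(\<lambda>x. s\<^sup>2 * (f x)\<^sup>2 + 2 * s * t * (f x * g x) + t\<^sup>2 * (g x)\<^sup>2)
      = (\<lambda>x. (s * f x + t * g x)\<^sup>2)"
    by (simp add: power2_sum power_mult_distrib algebra_simps)
  finally show ?thesis using assms by (auto simp: square_integrable_def)
qed

lemma square_integrable_diff:
  assumes "square_integrable M f" "square_integrable M g"
  shows "square_integrable M (\<lambda>x. f x - g x)"
  using square_integrable_lincomb[OF assms, of 1 "-1"] by simp

text \<open>The terms of a summable series are bounded, say by \<open>B\<close>, so the k-th step is
  at most \<open>sqrt B\<close> times \<open>2^(-k/2)\<close>; a geometric series dominates the
  telescoping one.\<close>

lemma convergent_if_geometric_steps: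
  fixes a :: "nat \<Rightarrow> real"
  assumes "summable (\<lambda>k. 2 ^ k * (a (Suc k) - a k)\<^sup>2)"
  shows "convergent a"
proof -
  obtain B where B: "\<And>k. 2 ^ k * (a (Suc k) - a k)\<^sup>2 \<le> B"
    using Bseq_bdd_above[OF convergent_imp_Bseq[OF convergentI[OF summable_LIMSEQ_zero[OF assms]]]]
    unfolding bdd_above_def by auto
  have B0: "0 \<le> B" using B[of 0] by (rule order_trans[rotated]) simp
  have bound: "\<bar>a (Suc k) - a k\<bar> \<le> sqrt B * (1 / sqrt 2) ^ k" for k
  proof -
    have "(a (Suc k) - a k)\<^sup>2 \<le> B / 2 ^ k" using B[of k] by (simp add: field_simps)
    then have "sqrt ((a (Suc k) - a k)\<^sup>2) \<le> sqrt (B / 2 ^ k)" by (rule real_sqrt_le_mono)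
    then show ?thesis
      unfolding real_sqrt_abs real_sqrt_divide by (simp add: real_sqrt_power power_one_over)
  qed
  have "summable (\<lambda>k. sqrt B * (1 / sqrt 2) ^ k)"
    by (intro summable_mult summable_geometric) simp
  then have "summable (\<lambda>k. a (Suc k) - a k)"
    by (rule summable_comparison_test'[where N = 0]) (use bound in auto)
  then have "convergent (\<lambda>n. \<Sum>k<n. a (Suc k) - a k)" by (simp add: summable_iff_convergent)
  then have "convergent (\<lambda>n. a n - a 0)" by (simp add: sum_lessThan_telescope)
  then show ?thesis by (simp add: convergent_diff_const_right_iff)
qed

lemma nn_integral_square:
  assumes "square_integrable M f"
  shows "(\<integral>\<^sup>+x. ennreal ((f x)\<^sup>2) \<partial>M) = ennreal (LINT x|M. (f x)\<^sup>2)"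
  using assms by (intro nn_integral_eq_integral) (auto simp: square_integrable_def)

text \<open>
  The rate \<open>8\<^sup>-\<^sup>k\<close> leaves \<open>\<Sum>\<^sub>k 2\<^sup>k (g\<^sub>k\<^sub>+\<^sub>1 - g\<^sub>k)\<^sup>2\<close> integrable, hence finite almost everywhere, so the
  sequence converges pointwise almost everywhere.
\<close>

lemma L2_complete:
  fixes g :: "nat \<Rightarrow> 'a \<Rightarrow> real"
  assumes g: "\<And>k. square_integrable M (g k)"
    and cauchy: "\<And>k l. k \<le> l \<Longrightarrow> (LINT x|M. (g l x - g k x)\<^sup>2) \<le> C / 8 ^ k"
  shows "\<exists>h. square_integrable M h \<and> (\<forall>k. (LINT x|M. (h x - g k x)\<^sup>2) \<le> C / 8 ^ k)"
proof -
  have [measurable]: "g k \<in> borel_measurable M" for k using g by (simp add: square_integrable_def)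
  have C: "0 \<le> C" using cauchy[of 0 0] by simp
  \<comment> \<open>\<open>lim\<close> is unspecified where the sequence diverges, which will turn
    out to be a null set.\<close>
  define h where "h x = lim (\<lambda>k. g k x)" for x
  have h[measurable]: "h \<in> borel_measurable M" unfolding h_def by measurable
  have nn: "(\<integral>\<^sup>+x. ennreal ((g l x - g k x)\<^sup>2) \<partial>M) \<le> ennreal (C / 8 ^ k)" if "k \<le> l" for k l
    unfolding nn_integral_square[OF square_integrable_diff[OF g g]]
    using cauchy[OF that] by (rule ennreal_leI)
  have "(\<integral>\<^sup>+x. (\<Sum>k. ennreal (2 ^ k * (g (Suc k) x - g k x)\<^sup>2)) \<partial>M)
      = (\<Sum>k. \<integral>\<^sup>+x. ennreal (2 ^ k * (g (Suc k) x - g k x)\<^sup>2) \<partial>M)"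
    by (rule nn_integral_suminf) measurable
  also have "\<dots> \<le> (\<Sum>k. ennreal (C * (1 / 4) ^ k))"
  proof (rule suminf_le)
    fix k
    have "(\<integral>\<^sup>+x. ennreal (2 ^ k * (g (Suc k) x - g k x)\<^sup>2) \<partial>M)
        = ennreal (2 ^ k) * (\<integral>\<^sup>+x. ennreal ((g (Suc k) x - g k x)\<^sup>2) \<partial>M)"
      by (subst nn_integral_cmult[symmetric]) (auto simp: ennreal_mult)
    also have "\<dots> \<le> ennreal (2 ^ k) * ennreal (C / 8 ^ k)"
      by (intro mult_left_mono nn) auto
    also have "\<dots> = ennreal (2 ^ k * (C / 8 ^ k))"
      using C by (subst ennreal_mult) auto
    also have "2 ^ k * (C / 8 ^ k) = C * (1 / 4) ^ k"
    proof -
      have "(8::real) ^ k = 2 ^ k * 4 ^ k" by (simp add: power_mult_distrib[symmetric])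
      then show ?thesis by (simp add: power_one_over)
    qed
    finally show "(\<integral>\<^sup>+x. ennreal (2 ^ k * (g (Suc k) x - g k x)\<^sup>2) \<partial>M) \<le> ennreal (C * (1 / 4) ^ k)" .
  qed auto
  also have "\<dots> < \<infinity>"
  proof -
    have "summable (\<lambda>k. C * (1 / 4) ^ k)" by (intro summable_mult summable_geometric) simp
    then have "(\<Sum>k. ennreal (C * (1 / 4) ^ k)) = ennreal (\<Sum>k. C * (1 / 4) ^ k)"
      using C by (intro suminf_ennreal2) auto
    then show ?thesis by simp
  qed
  finally have fin: "(\<integral>\<^sup>+x. (\<Sum>k. ennreal (2 ^ k * (g (Suc k) x - g k x)\<^sup>2)) \<partial>M) \<noteq> \<infinity>" by simp
  have "AE x in M. (\<Sum>k. ennreal (2 ^ k * (g (Suc k) x - g k x)\<^sup>2)) \<noteq> \<infinity>"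
    by (rule nn_integral_PInf_AE[OF _ fin]) measurable
  then have conv: "AE x in M. (\<lambda>k. g k x) \<longlonglongrightarrow> h x"
  proof eventually_elim
    fix x assume "(\<Sum>k. ennreal (2 ^ k * (g (Suc k) x - g k x)\<^sup>2)) \<noteq> \<infinity>"
    then have "summable (\<lambda>k. 2 ^ k * (g (Suc k) x - g k x)\<^sup>2)"
      by (intro summable_suminf_not_top) auto
    then show "(\<lambda>k. g k x) \<longlonglongrightarrow> h x"
      unfolding h_def convergent_LIMSEQ_iff[symmetric] by (rule convergent_if_geometric_steps)
  qed
  \<comment> \<open>Fatou is applied in \<open>l\<close> with \<open>k\<close> fixed, so the Cauchy
    bound passes unchanged to the distance of \<open>h\<close> from \<open>g k\<close>. For
    \<open>k = 0\<close> it also puts \<open>h\<close> into L2.\<close>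
  have fatou: "(\<integral>\<^sup>+x. ennreal ((h x - g k x)\<^sup>2) \<partial>M) \<le> ennreal (C / 8 ^ k)" for k
  proof -
    have "(\<integral>\<^sup>+x. ennreal ((h x - g k x)\<^sup>2) \<partial>M)
        = (\<integral>\<^sup>+x. liminf (\<lambda>l. ennreal ((g l x - g k x)\<^sup>2)) \<partial>M)"
    proof (rule nn_integral_cong_AE, use conv in eventually_elim)
      fix x assume "(\<lambda>k. g k x) \<longlonglongrightarrow> h x"
      then have "(\<lambda>l. ennreal ((g l x - g k x)\<^sup>2)) \<longlonglongrightarrow> ennreal ((h x - g k x)\<^sup>2)"
        by (intro tendsto_ennrealI tendsto_intros)
      then show "ennreal ((h x - g k x)\<^sup>2) = liminf (\<lambda>l. ennreal ((g l x - g k x)\<^sup>2))"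
        by (intro lim_imp_Liminf[symmetric]) auto
    qed
    also have "\<dots> \<le> liminf (\<lambda>l. \<integral>\<^sup>+x. ennreal ((g l x - g k x)\<^sup>2) \<partial>M)"
      by (rule nn_integral_liminf) measurable
    also have "\<dots> \<le> limsup (\<lambda>l. \<integral>\<^sup>+x. ennreal ((g l x - g k x)\<^sup>2) \<partial>M)"
      by (rule Liminf_le_Limsup) simp
    also have "\<dots> \<le> ennreal (C / 8 ^ k)"
      by (rule Limsup_bounded) (auto simp: eventually_sequentially intro!: exI[of _ k] nn)
    finally show ?thesis .
  qed
  have diff: "square_integrable M (\<lambda>x. h x - g k x)" for k
  proof -
    have "(\<integral>\<^sup>+x. ennreal (norm ((h x - g k x)\<^sup>2)) \<partial>M) < \<infinity>"
      using le_less_trans[OF fatou[of k]] by simp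
    then show ?thesis unfolding square_integrable_def by (auto intro: integrableI_bounded)
  qed
  have "square_integrable M h"
    using square_integrable_lincomb[OF diff[of 0] g[of 0], of 1 1] by simp
  moreover have "(LINT x|M. (h x - g k x)\<^sup>2) \<le> C / 8 ^ k" for k
    using fatou[of k] C unfolding nn_integral_square[OF diff] by (simp add: ennreal_le_iff)
  ultimately show ?thesis by blast
qed


section \<open>Finite families in L2: the Hilbert space of algebra-valued functions in
  coordinates\<close>

definition L2_inner :: "'a measure \<Rightarrow> 'i set \<Rightarrow> ('i \<Rightarrow> 'a \<Rightarrow> real) \<Rightarrow> ('i \<Rightarrow> 'a \<Rightarrow> real) \<Rightarrow> real" where
  "L2_inner M I f g = (\<Sum>i\<in>I. LINT x|M. f i x * g i x)"

definition L2_family :: "'a measure \<Rightarrow> 'i set \<Rightarrow> ('i \<Rightarrow> 'a \<Rightarrow> real) \<Rightarrow> bool" where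
  "L2_family M I f \<longleftrightarrow> (\<forall>i\<in>I. square_integrable M (f i))"

lemma L2_inner_commute: "L2_inner M I f g = L2_inner M I g f"
  by (simp add: L2_inner_def mult.commute)

lemma L2_inner_ge_0: "0 \<le> L2_inner M I f f"
  by (auto simp: L2_inner_def intro!: sum_nonneg)

lemma L2_inner_cong:
  assumes "\<And>i x. i \<in> I \<Longrightarrow> x \<in> space M \<Longrightarrow> f i x = f' i x"
    and "\<And>i x. i \<in> I \<Longrightarrow> x \<in> space M \<Longrightarrow> g i x = g' i x"
  shows "L2_inner M I f g = L2_inner M I f' g'"
  unfolding L2_inner_def using assms by (intro sum.cong Bochner_Integration.integral_cong) auto

lemma L2_family_lincomb:
  "L2_family M I f \<Longrightarrow> L2_family M I g \<Longrightarrow> L2_family M I (\<lambda>i x. s * f i x + t * g i x)"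
  by (simp add: L2_family_def square_integrable_lincomb)

lemma L2_inner_lincomb_left:
  assumes "L2_family M I f" "L2_family M I g" "L2_family M I h"
  shows "L2_inner M I (\<lambda>i x. s * f i x + t * g i x) h = s * L2_inner M I f h + t * L2_inner M I g h"
proof -
  have "(LINT x|M. (s * f i x + t * g i x) * h i x)
      = s * (LINT x|M. f i x * h i x) + t * (LINT x|M. g i x * h i x)" if "i \<in> I" for i
  proof -
    have "integrable M (\<lambda>x. f i x * h i x)" "integrable M (\<lambda>x. g i x * h i x)"
      using assms that by (auto simp: L2_family_def intro: square_integrable_mult)
    moreover have "(\<lambda>x. (s * f i x + t * g i x) * h i x)
        = (\<lambda>x. s * (f i x * h i x) + t * (g i x * h i x))"
      by (simp add: algebra_simps)
    ultimately show ?thesis by simp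
  qed
  then show ?thesis by (simp add: L2_inner_def sum.distrib sum_distrib_left)
qed

lemma L2_inner_lincomb_self:
  assumes "L2_family M I f" "L2_family M I g"
  shows "L2_inner M I (\<lambda>i x. s * f i x + t * g i x) (\<lambda>i x. s * f i x + t * g i x)
    = s\<^sup>2 * L2_inner M I f f + 2 * s * t * L2_inner M I f g + t\<^sup>2 * L2_inner M I g g"
proof -
  let ?h = "\<lambda>i x. s * f i x + t * g i x"
  have h: "L2_family M I ?h" using assms by (rule L2_family_lincomb)
  have "L2_inner M I f ?h = s * L2_inner M I f f + t * L2_inner M I f g"
    unfolding L2_inner_commute[of M I f ?h] L2_inner_lincomb_left[OF assms assms(1)]
    by (simp add: L2_inner_commute[of M I g f])
  moreover have "L2_inner M I g ?h = s * L2_inner M I f g + t * L2_inner M I g g"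
    unfolding L2_inner_commute[of M I g ?h] L2_inner_lincomb_left[OF assms assms(2)] ..
  ultimately show ?thesis
    unfolding L2_inner_lincomb_left[OF assms h] by (simp add: algebra_simps power2_eq_square)
qed

lemma L2_Cauchy_Schwarz:
  assumes "L2_family M I f" "L2_family M I g"
  shows "(L2_inner M I f g)\<^sup>2 \<le> L2_inner M I f f * L2_inner M I g g"
proof -
  let ?a = "L2_inner M I f f" and ?b = "L2_inner M I f g" and ?c = "L2_inner M I g g"
  have *: "0 \<le> s\<^sup>2 * ?a + 2 * s * t * ?b + t\<^sup>2 * ?c" for s t
    using L2_inner_ge_0[of M I "\<lambda>i x. s * f i x + t * g i x"]
    unfolding L2_inner_lincomb_self[OF assms] .
  show ?thesis
  proof (cases "?c = 0")
    case True
    have "?b = 0"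
    proof (rule ccontr)
      assume "?b \<noteq> 0"
      \<comment> \<open>For \<open>?c = 0\<close> and \<open>s = 1\<close> the quadratic form is
        affine in \<open>t\<close>; this \<open>t\<close> gives it the value -1.\<close>
      with *[of 1 "- (?a + 1) / (2 * ?b)"] True show False
        using L2_inner_ge_0[of M I f] by (simp add: field_simps)
    qed
    with True show ?thesis by simp
  next
    case False
    then have c: "0 < ?c" using L2_inner_ge_0[of M I g] by simp
    \<comment> \<open>The pair \<open>s = ?c\<close>, \<open>t = - ?b\<close> minimizes the form up
      to scaling.\<close>
    have "0 \<le> ?c * (?a * ?c - ?b\<^sup>2)"
      using *[of ?c "- ?b"] by (simp add: algebra_simps power2_eq_square)
    then show ?thesis using c by (simp add: zero_le_mult_iff)
  qed
qed

text \<open>Each component is dominated by the whole sum of nonnegative terms, so all components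
  inherit the same rate and \<open>L2_complete\<close> applies to each. Finiteness of
  \<open>I\<close> lets the errors be added up again.\<close>

lemma L2_family_complete:
  fixes g :: "nat \<Rightarrow> 'i \<Rightarrow> 'a \<Rightarrow> real"
  assumes I: "finite I" and g: "\<And>k. L2_family M I (g k)"
    and cauchy: "\<And>k l. k \<le> l \<Longrightarrow>
      L2_inner M I (\<lambda>i x. g l i x - g k i x) (\<lambda>i x. g l i x - g k i x) \<le> C / 8 ^ k"
  shows "\<exists>h. L2_family M I h \<and>
    (\<lambda>k. L2_inner M I (\<lambda>i x. h i x - g k i x) (\<lambda>i x. h i x - g k i x)) \<longlonglongrightarrow> 0"
proof -
  have "\<exists>h. square_integrable M h \<and> (\<forall>k. (LINT x|M. (h x - g k i x)\<^sup>2) \<le> C / 8 ^ k)"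
    if i: "i \<in> I" for i
  proof (rule L2_complete)
    show "square_integrable M (g k i)" for k using g i by (simp add: L2_family_def)
    fix k l :: nat assume kl: "k \<le> l"
    have "(LINT x|M. (g l i x - g k i x)\<^sup>2)
        \<le> L2_inner M I (\<lambda>i x. g l i x - g k i x) (\<lambda>i x. g l i x - g k i x)"
      unfolding L2_inner_def power2_eq_square
      by (rule member_le_sum[OF i _ I]) (auto intro!: Bochner_Integration.integral_nonneg)
    with cauchy[OF kl] show "(LINT x|M. (g l i x - g k i x)\<^sup>2) \<le> C / 8 ^ k" by simp
  qed
  then obtain h where h: "\<And>i. i \<in> I \<Longrightarrow> square_integrable M (h i)"
      "\<And>i k. i \<in> I \<Longrightarrow> (LINT x|M. (h i x - g k i x)\<^sup>2) \<le> C / 8 ^ k"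
    by metis
  have "(\<lambda>k. L2_inner M I (\<lambda>i x. h i x - g k i x) (\<lambda>i x. h i x - g k i x)) \<longlonglongrightarrow> 0"
  proof (rule tendsto_sandwich)
    show "\<forall>\<^sub>F k in sequentially.
        0 \<le> L2_inner M I (\<lambda>i x. h i x - g k i x) (\<lambda>i x. h i x - g k i x)"
      by (simp add: L2_inner_ge_0)
    have "L2_inner M I (\<lambda>i x. h i x - g k i x) (\<lambda>i x. h i x - g k i x)
        \<le> (\<Sum>i\<in>I. C * (1 / 8) ^ k)" for k
      unfolding L2_inner_def using h(2)
      by (intro sum_mono) (simp add: power2_eq_square power_one_over)
    then show "\<forall>\<^sub>F k in sequentially.
        L2_inner M I (\<lambda>i x. h i x - g k i x) (\<lambda>i x. h i x - g k i x) \<le> (\<Sum>i\<in>I. C * (1 / 8) ^ k)"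
      by simp
    show "(\<lambda>k. \<Sum>i\<in>I. C * (1 / 8) ^ k) \<longlonglongrightarrow> 0"
      by (intro tendsto_null_sum tendsto_mult_right_zero LIMSEQ_power_zero) simp
  qed simp
  with h(1) show ?thesis by (auto simp: L2_family_def)
qed

lemma L2_inner_tendsto:
  assumes g: "\<And>k. L2_family M I (g k)" and h: "L2_family M I h" and f: "L2_family M I f"
    and lim: "(\<lambda>k. L2_inner M I (\<lambda>i x. h i x - g k i x) (\<lambda>i x. h i x - g k i x)) \<longlonglongrightarrow> 0"
  shows "(\<lambda>k. L2_inner M I (g k) f) \<longlonglongrightarrow> L2_inner M I h f"
proof -
  have d: "L2_family M I (\<lambda>i x. h i x - g k i x)" for k
    using L2_family_lincomb[OF h g[of k], of 1 "-1"] by simp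
  have e: "L2_inner M I (\<lambda>i x. h i x - g k i x) f = L2_inner M I h f - L2_inner M I (g k) f" for k
    using L2_inner_lincomb_left[OF h g f, of 1 "-1" k] by simp
  have "(\<lambda>k. (L2_inner M I h f - L2_inner M I (g k) f)\<^sup>2) \<longlonglongrightarrow> 0"
  proof (rule tendsto_sandwich)
    show "\<forall>\<^sub>F k in sequentially. 0 \<le> (L2_inner M I h f - L2_inner M I (g k) f)\<^sup>2" by simp
    show "\<forall>\<^sub>F k in sequentially. (L2_inner M I h f - L2_inner M I (g k) f)\<^sup>2
        \<le> L2_inner M I (\<lambda>i x. h i x - g k i x) (\<lambda>i x. h i x - g k i x) * L2_inner M I f f"
      using L2_Cauchy_Schwarz[OF d f] by (simp add: e)
    show "(\<lambda>k. L2_inner M I (\<lambda>i x. h i x - g k i x) (\<lambda>i x. h i x - g k i x) * L2_inner M I f f)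
        \<longlonglongrightarrow> 0"
      by (rule tendsto_mult_left_zero[OF lim])
  qed simp
  then have "(\<lambda>k. sqrt ((L2_inner M I h f - L2_inner M I (g k) f)\<^sup>2)) \<longlonglongrightarrow> sqrt 0"
    by (rule tendsto_real_sqrt)
  then have "(\<lambda>k. L2_inner M I h f - L2_inner M I (g k) f) \<longlonglongrightarrow> 0"
    by (simp add: tendsto_rabs_zero_iff)
  from tendsto_diff[OF tendsto_const[of "L2_inner M I h f"] this] show ?thesis by simp
qed

text \<open>
  The representing element is the limit of a minimizing sequence of the functional
  \<open>\<parallel>T \<alpha>\<parallel>\<^sup>2 - 2 l \<alpha>\<close>.
\<close>

lemma L2_riesz:
  fixes T :: "'b \<Rightarrow> 'i \<Rightarrow> 'a \<Rightarrow> real" and l :: "'b \<Rightarrow> real"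
  assumes I: "finite I" and ne: "V \<noteq> {}" and K: "0 \<le> K"
    and T: "\<And>\<alpha>. \<alpha> \<in> V \<Longrightarrow> L2_family M I (T \<alpha>)"
    and linear: "\<And>\<alpha> \<beta> s t. \<alpha> \<in> V \<Longrightarrow> \<beta> \<in> V \<Longrightarrow> \<exists>\<gamma>\<in>V. l \<gamma> = s * l \<alpha> + t * l \<beta> \<and>
      (\<forall>i\<in>I. \<forall>x\<in>space M. T \<gamma> i x = s * T \<alpha> i x + t * T \<beta> i x)"
    and bound: "\<And>\<alpha>. \<alpha> \<in> V \<Longrightarrow> (l \<alpha>)\<^sup>2 \<le> K * L2_inner M I (T \<alpha>) (T \<alpha>)"
  shows "\<exists>w. L2_family M I w \<and> (\<forall>\<alpha>\<in>V. l \<alpha> = L2_inner M I w (T \<alpha>)) \<and> L2_inner M I w w \<le> K"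
proof -
  define Q where "Q \<alpha> = L2_inner M I (T \<alpha>) (T \<alpha>)" for \<alpha>
  define J where "J \<alpha> = Q \<alpha> - 2 * l \<alpha>" for \<alpha>
  \<comment> \<open>The bound on \<open>l\<close> and the inequality between arithmetic and
    geometric mean give \<open>2 * \<bar>l \<alpha>\<bar> \<le> Q \<alpha> + K\<close>.\<close>
  have J_ge: "- K \<le> J \<alpha>" if "\<alpha> \<in> V" for \<alpha>
  proof -
    have "0 \<le> (Q \<alpha> - K)\<^sup>2" by simp
    then have "4 * (K * Q \<alpha>) \<le> (Q \<alpha> + K)\<^sup>2" by (simp add: power2_eq_square algebra_simps)
    with bound[OF that] have "(2 * l \<alpha>)\<^sup>2 \<le> (Q \<alpha> + K)\<^sup>2"
      by (simp add: Q_def power_mult_distrib)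
    moreover have "0 \<le> Q \<alpha> + K" using K L2_inner_ge_0[of M I] by (simp add: Q_def)
    ultimately have "\<bar>2 * l \<alpha>\<bar> \<le> Q \<alpha> + K" by (metis abs_le_square_iff abs_of_nonneg)
    then show ?thesis by (simp add: J_def)
  qed
  have Q_comb: "L2_inner M I (T \<gamma>) (T \<gamma>)
      = s\<^sup>2 * Q \<alpha> + 2 * s * t * L2_inner M I (T \<alpha>) (T \<beta>) + t\<^sup>2 * Q \<beta>"
    if "\<alpha> \<in> V" "\<beta> \<in> V" "\<forall>i\<in>I. \<forall>x\<in>space M. T \<gamma> i x = s * T \<alpha> i x + t * T \<beta> i x" for \<alpha> \<beta> \<gamma> s t
  proof -
    have "L2_inner M I (T \<gamma>) (T \<gamma>)
        = L2_inner M I (\<lambda>i x. s * T \<alpha> i x + t * T \<beta> i x) (\<lambda>i x. s * T \<alpha> i x + t * T \<beta> i x)"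
      using that by (intro L2_inner_cong) auto
    then show ?thesis using that by (simp add: L2_inner_lincomb_self T Q_def)
  qed
  define m where "m = (INF \<alpha>\<in>V. J \<alpha>)"
  have bdd: "bdd_below (J ` V)" using J_ge by (intro bdd_belowI2[where m = "- K"])
  have m_le: "m \<le> J \<alpha>" if "\<alpha> \<in> V" for \<alpha>
    unfolding m_def using that by (rule cINF_lower[OF bdd])
  have "\<exists>\<alpha>\<in>V. J \<alpha> < m + (1 / 8) ^ k" for k
    using cINF_less_iff[OF ne bdd, of "m + (1 / 8) ^ k"] by (simp add: m_def)
  then obtain a where aV: "\<And>k. a k \<in> V" and aJ: "\<And>k. J (a k) < m + (1 / 8) ^ k" by metis
  \<comment> \<open>Parallelogram law: the squared distance equals
    \<open>2 * (J (a j) + J (a k) - 2 * J \<gamma>)\<close> for the midpoint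
    \<open>\<gamma>\<close>, and \<open>J \<gamma> \<ge> m\<close>. The rate \<open>8^(-k)\<close>
    of the minimizing sequence is the one that \<open>L2_complete\<close> asks for.\<close>
  have cauchy: "L2_inner M I (\<lambda>i x. T (a j) i x - T (a k) i x) (\<lambda>i x. T (a j) i x - T (a k) i x)
      \<le> 4 / 8 ^ k" if kj: "k \<le> j" for j k
  proof -
    let ?b = "L2_inner M I (T (a j)) (T (a k))"
    obtain \<gamma> where \<gamma>: "\<gamma> \<in> V" "l \<gamma> = 1/2 * l (a j) + 1/2 * l (a k)"
      "\<forall>i\<in>I. \<forall>x\<in>space M. T \<gamma> i x = 1/2 * T (a j) i x + 1/2 * T (a k) i x"
      using linear[OF aV aV] by blast
    have "J \<gamma> = 1/4 * Q (a j) + 1/2 * ?b + 1/4 * Q (a k) - l (a j) - l (a k)"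
      using Q_comb[OF aV aV \<gamma>(3)] \<gamma>(2) by (simp add: J_def Q_def power2_eq_square)
    with m_le[OF \<gamma>(1)] aJ[of j] aJ[of k]
    have "Q (a j) - 2 * ?b + Q (a k) \<le> 2 * (1 / 8) ^ j + 2 * (1 / 8) ^ k"
      by (simp add: J_def)
    also have "(1 / 8 :: real) ^ j \<le> (1 / 8) ^ k" using kj by (intro power_decreasing) auto
    finally have "Q (a j) - 2 * ?b + Q (a k) \<le> 4 / 8 ^ k" by (simp add: power_one_over)
    moreover have "L2_inner M I (\<lambda>i x. T (a j) i x - T (a k) i x) (\<lambda>i x. T (a j) i x - T (a k) i x)
        = Q (a j) - 2 * ?b + Q (a k)"
      using L2_inner_lincomb_self[OF T[OF aV[of j]] T[OF aV[of k]], of 1 "-1"] by (simp add: Q_def)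
    ultimately show ?thesis by simp
  qed
  obtain w where w: "L2_family M I w" and
    wlim: "(\<lambda>k. L2_inner M I (\<lambda>i x. w i x - T (a k) i x) (\<lambda>i x. w i x - T (a k) i x)) \<longlonglongrightarrow> 0"
    using L2_family_complete[OF I T[OF aV] cauchy] by auto
  have lim: "(\<lambda>k. L2_inner M I (T (a k)) f) \<longlonglongrightarrow> L2_inner M I w f" if "L2_family M I f" for f
    using L2_inner_tendsto[OF T[OF aV] w that wlim] .
  have rep: "l \<beta> = L2_inner M I w (T \<beta>)" if \<beta>: "\<beta> \<in> V" for \<beta>
  proof -
    let ?e = "L2_inner M I w (T \<beta>) - l \<beta>"
    \<comment> \<open>First variation: moving \<open>a k\<close> by \<open>t\<close> times
      \<open>\<beta>\<close> cannot lower \<open>J\<close> by more than \<open>8^(-k)\<close>. In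
      the limit the slack disappears and \<open>w\<close> behaves like an exact minimizer.\<close>
    have ge: "0 \<le> 2 * t * ?e + t\<^sup>2 * Q \<beta>" for t
    proof (rule tendsto_lowerbound)
      show "(\<lambda>k. (1 / 8) ^ k + 2 * t * (L2_inner M I (T (a k)) (T \<beta>) - l \<beta>) + t\<^sup>2 * Q \<beta>)
          \<longlonglongrightarrow> 2 * t * ?e + t\<^sup>2 * Q \<beta>"
      proof -
        have "(\<lambda>k. (1 / 8) ^ k + 2 * t * (L2_inner M I (T (a k)) (T \<beta>) - l \<beta>) + t\<^sup>2 * Q \<beta>)
          \<longlonglongrightarrow> 0 + 2 * t * ?e + t\<^sup>2 * Q \<beta>"
          by (intro tendsto_intros lim T \<beta> LIMSEQ_power_zero) auto
        then show ?thesis by simp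
      qed
      have "0 \<le> (1 / 8) ^ k + 2 * t * (L2_inner M I (T (a k)) (T \<beta>) - l \<beta>) + t\<^sup>2 * Q \<beta>" for k
      proof -
        obtain \<gamma> where \<gamma>: "\<gamma> \<in> V" "l \<gamma> = 1 * l (a k) + t * l \<beta>"
          "\<forall>i\<in>I. \<forall>x\<in>space M. T \<gamma> i x = 1 * T (a k) i x + t * T \<beta> i x"
          using linear[OF aV \<beta>] by blast
        have "J \<gamma> = J (a k) + 2 * t * (L2_inner M I (T (a k)) (T \<beta>) - l \<beta>) + t\<^sup>2 * Q \<beta>"
          using Q_comb[OF aV \<beta> \<gamma>(3)] \<gamma>(2) by (simp add: J_def Q_def algebra_simps)
        with m_le[OF \<gamma>(1)] aJ[of k] show ?thesis by simp
      qed
      then show "\<forall>\<^sub>F k in sequentially.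
          0 \<le> (1 / 8) ^ k + 2 * t * (L2_inner M I (T (a k)) (T \<beta>) - l \<beta>) + t\<^sup>2 * Q \<beta>" by simp
    qed simp
    have "?e = 0"
    proof (rule ccontr)
      assume e: "?e \<noteq> 0"
      have q: "0 \<le> Q \<beta>" by (simp add: Q_def L2_inner_ge_0)
      \<comment> \<open>Nearly the minimizer \<open>- ?e / Q \<beta>\<close> of the quadratic; the
        added 1 keeps the denominator positive when \<open>Q \<beta> = 0\<close>.\<close>
      define t where "t = - ?e / (Q \<beta> + 1)"
      have te: "?e = - t * (Q \<beta> + 1)" using q by (simp add: t_def)
      then have "t \<noteq> 0" using e by auto
      have "2 * t * ?e + t\<^sup>2 * Q \<beta> = - t\<^sup>2 * (Q \<beta> + 2)"
        unfolding te by (simp add: algebra_simps power2_eq_square)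
      then have "t\<^sup>2 * (Q \<beta> + 2) \<le> 0" using ge[of t] by simp
      moreover have "0 < t\<^sup>2 * (Q \<beta> + 2)" using \<open>t \<noteq> 0\<close> q by (intro mult_pos_pos) auto
      ultimately show False by simp
    qed
    then show ?thesis by simp
  qed
  have "L2_inner M I w w \<le> K"
  proof -
    let ?W = "L2_inner M I w w"
    \<comment> \<open>Expanding the squared distance of \<open>w\<close> from
      \<open>T \<alpha>\<close> expresses \<open>Q\<close> by quantities with known limits. Since
      \<open>l (a k)\<close> tends to \<open>?W\<close>, the bound on \<open>l\<close> becomes
      \<open>?W\<^sup>2 \<le> K * ?W\<close>.\<close>
    have Q_lim: "Q \<alpha> = 2 * l \<alpha> - ?W + L2_inner M I (\<lambda>i x. w i x - T \<alpha> i x) (\<lambda>i x. w i x - T \<alpha> i x)"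
      if "\<alpha> \<in> V" for \<alpha>
      using L2_inner_lincomb_self[OF w T[OF that], of 1 "-1"] rep[OF that] by (simp add: Q_def)
    have le: "(l (a k))\<^sup>2 \<le> K * (2 * l (a k) - ?W
        + L2_inner M I (\<lambda>i x. w i x - T (a k) i x) (\<lambda>i x. w i x - T (a k) i x))" for k
      using bound[OF aV[of k]] unfolding Q_def[symmetric] Q_lim[OF aV[of k]] .
    have llim: "(\<lambda>k. l (a k)) \<longlonglongrightarrow> ?W"
      using lim[OF w] by (simp add: rep[OF aV] L2_inner_commute[of M I w "T _"])
    have "(\<lambda>k. (l (a k))\<^sup>2) \<longlonglongrightarrow> ?W\<^sup>2"
      by (intro tendsto_intros llim)
    moreover have "(\<lambda>k. K * (2 * l (a k) - ?W
        + L2_inner M I (\<lambda>i x. w i x - T (a k) i x) (\<lambda>i x. w i x - T (a k) i x)))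
        \<longlonglongrightarrow> K * (2 * ?W - ?W + 0)"
      by (intro tendsto_intros llim wlim)
    ultimately have "?W\<^sup>2 \<le> K * (2 * ?W - ?W + 0)"
      by (rule LIMSEQ_le) (use le in blast)
    then have "?W * (?W - K) \<le> 0" by (simp add: algebra_simps power2_eq_square)
    then show ?thesis using L2_inner_ge_0[of M I w] K
      by (smt (verit) mult_pos_pos)
  qed
  with w rep show ?thesis by blast
qed

section \<open>Smooth functions and mixed partial derivatives\<close>

text \<open>The mean value theorem is used in \<open>s\<close> on the difference of two slices, then
  in \<open>t\<close> on \<open>F1\<close>. The four-point expression is symmetric in the two
  variables, so the lemma also serves the opposite order of differentiation.\<close>

lemma mixed_difference_eq_mixed_derivative:
  fixes F F1 F12 :: "real \<Rightarrow> real \<Rightarrow> real"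
  assumes "0 < h"
    and F1: "\<And>s t. ((\<lambda>s. F s t) has_real_derivative F1 s t) (at s)"
    and F12: "\<And>s t. ((\<lambda>t. F1 s t) has_real_derivative F12 s t) (at t)"
  shows "\<exists>\<xi> \<eta>. \<bar>\<xi> - s\<bar> < h \<and> \<bar>\<eta> - t\<bar> < h \<and>
    F (s + h) (t + h) - F s (t + h) - F (s + h) t + F s t = h * h * F12 \<xi> \<eta>"
proof -
  have "\<exists>\<xi>. s < \<xi> \<and> \<xi> < s + h \<and> (F (s + h) (t + h) - F (s + h) t) - (F s (t + h) - F s t)
      = (s + h - s) * (F1 \<xi> (t + h) - F1 \<xi> t)"
    by (rule MVT2) (use \<open>0 < h\<close> in \<open>auto intro!: derivative_intros F1\<close>)
  then obtain \<xi> where \<xi>: "s < \<xi>" "\<xi> < s + h"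
    "(F (s + h) (t + h) - F (s + h) t) - (F s (t + h) - F s t) = h * (F1 \<xi> (t + h) - F1 \<xi> t)"
    by auto
  have "\<exists>\<eta>. t < \<eta> \<and> \<eta> < t + h \<and> F1 \<xi> (t + h) - F1 \<xi> t = (t + h - t) * F12 \<xi> \<eta>"
    by (rule MVT2) (use \<open>0 < h\<close> in \<open>auto intro!: F12\<close>)
  then obtain \<eta> where "t < \<eta>" "\<eta> < t + h" "F1 \<xi> (t + h) - F1 \<xi> t = h * F12 \<xi> \<eta>"
    by auto
  with \<xi> show ?thesis by (intro exI[of _ \<xi>] exI[of _ \<eta>]) (auto simp: algebra_simps)
qed

text \<open>The second difference over a small square equals \<open>h * h\<close> times a value of
  \<open>F12\<close> and also \<open>h * h\<close> times a value of \<open>F21\<close>, at points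
  close to \<open>(s, t)\<close>. Continuity forces both values to agree in the limit.\<close>

lemma mixed_derivatives_commute:
  fixes F F1 F2 F12 F21 :: "real \<Rightarrow> real \<Rightarrow> real"
  assumes F1: "\<And>s t. ((\<lambda>s. F s t) has_real_derivative F1 s t) (at s)"
    and F2: "\<And>s t. ((\<lambda>t. F s t) has_real_derivative F2 s t) (at t)"
    and F12: "\<And>s t. ((\<lambda>t. F1 s t) has_real_derivative F12 s t) (at t)"
    and F21: "\<And>s t. ((\<lambda>s. F2 s t) has_real_derivative F21 s t) (at s)"
    and cont12: "continuous_on UNIV (\<lambda>p. F12 (fst p) (snd p))"
    and cont21: "continuous_on UNIV (\<lambda>p. F21 (fst p) (snd p))"
  shows "F12 s t = F21 s t"
proof (rule ccontr)
  assume "F12 s t \<noteq> F21 s t"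
  then have e: "0 < \<bar>F12 s t - F21 s t\<bar> / 2" (is "0 < ?e") by simp
  obtain d1 where d1: "0 < d1"
    "\<And>p. dist p (s, t) < d1 \<Longrightarrow> dist (F12 (fst p) (snd p)) (F12 s t) < ?e"
    using cont12 e unfolding continuous_on_iff by (metis UNIV_I fst_conv snd_conv)
  obtain d2 where d2: "0 < d2"
    "\<And>p. dist p (s, t) < d2 \<Longrightarrow> dist (F21 (fst p) (snd p)) (F21 s t) < ?e"
    using cont21 e unfolding continuous_on_iff by (metis UNIV_I fst_conv snd_conv)
  \<comment> \<open>Half the radius, because the distance in the plane is estimated by the sum of
    two coordinate distances.\<close>
  define h where "h = min d1 d2 / 2"
  have h: "0 < h" using d1 d2 by (simp add: h_def)
  have close: "dist (\<xi>, \<eta>) (s, t) < min d1 d2" if "\<bar>\<xi> - s\<bar> < h" "\<bar>\<eta> - t\<bar> < h" for \<xi> \<eta>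
  proof -
    have "dist (\<xi>, \<eta>) (s, t) \<le> \<bar>\<xi> - s\<bar> + \<bar>\<eta> - t\<bar>"
      unfolding dist_Pair_Pair dist_real_def using sqrt_sum_squares_le_sum_abs by simp
    with that show ?thesis by (simp add: h_def)
  qed
  obtain \<xi> \<eta> where 1: "\<bar>\<xi> - s\<bar> < h" "\<bar>\<eta> - t\<bar> < h"
    "F (s + h) (t + h) - F s (t + h) - F (s + h) t + F s t = h * h * F12 \<xi> \<eta>"
    using mixed_difference_eq_mixed_derivative[OF h F1 F12] by blast
  obtain \<xi>' \<eta>' where 2: "\<bar>\<xi>' - s\<bar> < h" "\<bar>\<eta>' - t\<bar> < h"
    "F (s + h) (t + h) - F (s + h) t - F s (t + h) + F s t = h * h * F21 \<xi>' \<eta>'"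
    using mixed_difference_eq_mixed_derivative[of h "\<lambda>t s. F s t" "\<lambda>t s. F2 s t" "\<lambda>t s. F21 s t" t s,
        OF h F2 F21] by blast
  have "h * h * F12 \<xi> \<eta> = h * h * F21 \<xi>' \<eta>'" using 1(3) 2(3) by linarith
  then have "F12 \<xi> \<eta> = F21 \<xi>' \<eta>'" using h by simp
  moreover have "\<bar>F12 \<xi> \<eta> - F12 s t\<bar> < ?e"
    using d1(2)[of "(\<xi>, \<eta>)"] close[OF 1(1,2)] by (simp add: dist_real_def)
  moreover have "\<bar>F21 \<xi>' \<eta>' - F21 s t\<bar> < ?e"
    using d2(2)[of "(\<xi>', \<eta>')"] close[OF 2(1,2)] by (simp add: dist_real_def)
  ultimately show False by (smt (verit) field_sum_of_halves)
qed

section \<open>Calculus along coordinate lines of \<open>Rn1\<close>\<close>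

lemma fun_upd_in_Rn1: "x \<in> Rn1 n \<Longrightarrow> i \<le> n \<Longrightarrow> x(i := t) \<in> Rn1 n"
  by (auto simp: Rn1_def PiE_iff extensional_def)

text \<open>Extensionality is a family of closed conditions on coordinates. Closedness later makes a
  function that is continuous on \<open>Rn1 n\<close> Borel after extension by zero.\<close>

lemma closed_Rn1: "closed (Rn1 n)"
proof -
  have "Rn1 n = (\<Inter>j\<in>{n<..}. {x. x j = undefined})"
    by (auto simp: Rn1_def PiE_iff extensional_def)
  moreover have "closed {x :: nat \<Rightarrow> real. x j = undefined}" for j
    by (intro closed_Collect_eq continuous_on_product_coordinates continuous_on_const)
  ultimately show ?thesis by auto
qed

lemma continuous_on_fun_upd:
  assumes "continuous_on S f" "continuous_on S g"
  shows "continuous_on S (\<lambda>p. (f p)(i := g p :: real))"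
proof (rule continuous_on_coordinatewise_then_product)
  fix j
  show "continuous_on S (\<lambda>p. ((f p)(i := g p)) j)"
    using assms continuous_on_product_then_coordinatewise[OF assms(1), of j]
    by (cases "j = i") auto
qed

lemma partial_eqI:
  assumes "((\<lambda>t. g (x(i := t))) has_real_derivative d) (at (x i))"
  shows "partial i g x = d"
  unfolding partial_def using assms by (rule DERIV_imp_deriv)

text \<open>Coordinate lines with index at most \<open>n\<close> stay in \<open>Rn1 n\<close>. Hence
  identities known only on \<open>Rn1 n\<close> can be differentiated again, which every induction
  over iterated partial derivatives requires.\<close>

lemma partial_cong:
  assumes "\<And>y. y \<in> Rn1 n \<Longrightarrow> g y = h y" "x \<in> Rn1 n" "i \<le> n"
  shows "partial i g x = partial i h x"
proof -
  have "(\<lambda>t. g (x(i := t))) = (\<lambda>t. h (x(i := t)))"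
    using assms by (auto simp: fun_upd_in_Rn1)
  then show ?thesis by (simp add: partial_def)
qed

lemma smooth_continuous: "smooth n g \<Longrightarrow> continuous_on (Rn1 n) g"
  unfolding smooth_def by (drule spec[of _ "[]"]) simp

text \<open>\<open>smooth\<close> gives differentiability only at the parameter \<open>x i\<close>
  of the base point; moving the base point to \<open>x(i := t)\<close> yields it at every
  \<open>t\<close>.\<close>

lemma smooth_has_partial:
  assumes "smooth n g" "i \<le> n" "x \<in> Rn1 n"
  shows "((\<lambda>t. g (x(i := t))) has_real_derivative partial i g (x(i := t))) (at t)"
proof -
  have "(\<lambda>s. foldr partial [] g ((x(i := t))(i := s))) differentiable (at ((x(i := t)) i))"
    using assms fun_upd_in_Rn1[of x n i t] unfolding smooth_def by (metis empty_iff empty_set subsetI)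
  then have "(\<lambda>s. g (x(i := s))) differentiable (at t)" by simp
  then show ?thesis by (simp add: partial_def DERIV_deriv_iff_real_differentiable)
qed

lemma smooth_partial:
  assumes "smooth n g" "i \<le> n"
  shows "smooth n (partial i g)"
  unfolding smooth_def
proof (intro allI impI)
  fix js :: "nat list" assume "set js \<subseteq> {..n}"
  \<comment> \<open>\<open>foldr\<close> applies the last entry of the list first, so the derivative
    taken before all others is appended at the end.\<close>
  then have "set (js @ [i]) \<subseteq> {..n}" using assms(2) by auto
  with assms(1) have "continuous_on (Rn1 n) (foldr partial (js @ [i]) g) \<and>
      (\<forall>k\<le>n. \<forall>x\<in>Rn1 n. (\<lambda>t. foldr partial (js @ [i]) g (x(k := t))) differentiable at (x k))"
    unfolding smooth_def by blast
  then show "continuous_on (Rn1 n) (foldr partial js (partial i g)) \<and>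
      (\<forall>k\<le>n. \<forall>x\<in>Rn1 n. (\<lambda>t. foldr partial js (partial i g) (x(k := t))) differentiable at (x k))"
    by simp
qed

lemma smooth_foldr_partial:
  "smooth n g \<Longrightarrow> set js \<subseteq> {..n} \<Longrightarrow> smooth n (foldr partial js g)"
  by (induction js) (auto intro: smooth_partial)

lemma partial_lincomb:
  assumes "smooth n g" "smooth n h" "x \<in> Rn1 n" "i \<le> n"
  shows "partial i (\<lambda>y. s * g y + t * h y) x = s * partial i g x + t * partial i h x"
  using smooth_has_partial[OF assms(1,4,3), of "x i"] smooth_has_partial[OF assms(2,4,3), of "x i"]
  by (intro partial_eqI) (auto intro!: derivative_eq_intros)

lemma foldr_partial_lincomb:
  assumes "smooth n g" "smooth n h" "x \<in> Rn1 n" "set js \<subseteq> {..n}"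
  shows "foldr partial js (\<lambda>y. s * g y + t * h y) x = s * foldr partial js g x + t * foldr partial js h x"
  using assms(3,4)
proof (induction js arbitrary: x)
  case (Cons j js)
  have "foldr partial (j # js) (\<lambda>y. s * g y + t * h y) x
      = partial j (\<lambda>y. s * foldr partial js g y + t * foldr partial js h y) x"
    using Cons by (auto intro: partial_cong)
  also have "\<dots> = s * foldr partial (j # js) g x + t * foldr partial (j # js) h x"
    using partial_lincomb[OF smooth_foldr_partial[OF assms(1)] smooth_foldr_partial[OF assms(2)], of js js x j]
      Cons.prems by simp
  finally show ?case .
qed simp

lemma smooth_lincomb:
  assumes "smooth n g" "smooth n h"
  shows "smooth n (\<lambda>y. s * g y + t * h y)"
  unfolding smooth_def
proof (intro allI impI conjI ballI)
  fix js :: "nat list" assume js: "set js \<subseteq> {..n}"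
  have sm: "smooth n (foldr partial js g)" "smooth n (foldr partial js h)"
    using assms js by (auto intro: smooth_foldr_partial)
  show "continuous_on (Rn1 n) (foldr partial js (\<lambda>y. s * g y + t * h y))"
  proof (subst continuous_on_cong[OF refl])
    show "foldr partial js (\<lambda>y. s * g y + t * h y) x = s * foldr partial js g x + t * foldr partial js h x"
      if "x \<in> Rn1 n" for x using foldr_partial_lincomb[OF assms that js] .
    show "continuous_on (Rn1 n) (\<lambda>x. s * foldr partial js g x + t * foldr partial js h x)"
      by (intro continuous_intros smooth_continuous sm)
  qed
  fix k x assume k: "k \<le> n" and x: "x \<in> Rn1 n"
  have "(\<lambda>r. foldr partial js (\<lambda>y. s * g y + t * h y) (x(k := r)))
      = (\<lambda>r. s * foldr partial js g (x(k := r)) + t * foldr partial js h (x(k := r)))"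
    using foldr_partial_lincomb[OF assms fun_upd_in_Rn1[OF x k] js] by simp
  moreover have "((\<lambda>r. s * foldr partial js g (x(k := r)) + t * foldr partial js h (x(k := r)))
      has_real_derivative s * partial k (foldr partial js g) (x(k := x k))
        + t * partial k (foldr partial js h) (x(k := x k))) (at (x k))"
    by (intro DERIV_add DERIV_cmult smooth_has_partial[OF sm(1) k x] smooth_has_partial[OF sm(2) k x])
  ultimately show "(\<lambda>r. foldr partial js (\<lambda>y. s * g y + t * h y) (x(k := r))) differentiable at (x k)"
    by (auto simp: real_differentiable_def)
qed

text \<open>For distinct indices, restriction to the plane \<open>x(i := s, j := t)\<close> reduces
  the claim to functions of two real variables.\<close>

lemma partial_commute:
  assumes g: "smooth n g" and i: "i \<le> n" and j: "j \<le> n" and x: "x \<in> Rn1 n"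
  shows "partial i (partial j g) x = partial j (partial i g) x"
proof (cases "i = j")
  case False
  have twist: "x(i := s, j := t) = x(j := t, i := s)" for s t
    using False by (rule fun_upd_twist)
  have in_Rn1: "x(i := s, j := t) \<in> Rn1 n" for s t using x i j by (simp add: fun_upd_in_Rn1)
  have cont: "continuous_on UNIV (\<lambda>p. h (x(i := fst p, j := snd p)))" if "smooth n h" for h
    by (rule continuous_on_compose2[OF smooth_continuous[OF that]])
      ((intro continuous_on_fun_upd continuous_intros | use in_Rn1 in auto)+)
  have d1: "((\<lambda>s. h (x(i := s, j := t))) has_real_derivative partial i h (x(i := s, j := t))) (at s)"
    if "smooth n h" for h s t
    unfolding twist by (rule smooth_has_partial[OF that i fun_upd_in_Rn1[OF x j]])
  have d2: "((\<lambda>t. h (x(i := s, j := t))) has_real_derivative partial j h (x(i := s, j := t))) (at t)"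
    if "smooth n h" for h s t
    by (rule smooth_has_partial[OF that j fun_upd_in_Rn1[OF x i]])
  have "partial j (partial i g) (x(i := x i, j := x j)) = partial i (partial j g) (x(i := x i, j := x j))"
    by (rule mixed_derivatives_commute[where F = "\<lambda>s t. g (x(i := s, j := t))"
          and ?F1.0 = "\<lambda>s t. partial i g (x(i := s, j := t))"
          and ?F2.0 = "\<lambda>s t. partial j g (x(i := s, j := t))"
          and ?F12.0 = "\<lambda>s t. partial j (partial i g) (x(i := s, j := t))"
          and ?F21.0 = "\<lambda>s t. partial i (partial j g) (x(i := s, j := t))"])
      (intro d1 d2 cont smooth_partial g i j)+
  then show ?thesis by simp
qed simp

section \<open>Integration of test functions\<close>

text \<open>Fubini is applied to the uncompleted product, whose completion is \<open>leb\<close>.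
  Test functions are already measurable here, so their integrals carry over to
  \<open>leb\<close>.\<close>

abbreviation pleb :: "nat \<Rightarrow> (nat \<Rightarrow> real) measure" where
  "pleb n \<equiv> (\<Pi>\<^sub>M i\<in>{..n}. lborel)"

lemma space_pleb: "space (pleb n) = Rn1 n"
  by (simp add: space_PiM Rn1_def)

text \<open>A class just large enough for Fubini and boundary terms: it forgets the open set and
  smoothness, and is stable under multiplication by unbounded continuous weights such as
  \<open>x 0 - a\<close>.\<close>

definition Cc :: "nat \<Rightarrow> ((nat \<Rightarrow> real) \<Rightarrow> real) \<Rightarrow> bool" where
  "Cc n g \<longleftrightarrow> continuous_on (Rn1 n) g \<and>
     (\<exists>R. \<forall>x\<in>Rn1 n. g x \<noteq> 0 \<longrightarrow> (\<forall>i\<le>n. \<bar>x i\<bar> \<le> R))"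

lemma Cc_mult:
  assumes "Cc n g" "continuous_on (Rn1 n) h"
  shows "Cc n (\<lambda>x. g x * h x)"
  using assms unfolding Cc_def by (auto intro!: continuous_intros)

lemma Cc_add:
  assumes "Cc n g" "Cc n h"
  shows "Cc n (\<lambda>x. g x + h x)"
proof -
  obtain R S where R: "\<And>x i. x \<in> Rn1 n \<Longrightarrow> g x \<noteq> 0 \<Longrightarrow> i \<le> n \<Longrightarrow> \<bar>x i\<bar> \<le> R"
    and S: "\<And>x i. x \<in> Rn1 n \<Longrightarrow> h x \<noteq> 0 \<Longrightarrow> i \<le> n \<Longrightarrow> \<bar>x i\<bar> \<le> S"
    using assms unfolding Cc_def by blast
  have "\<bar>x i\<bar> \<le> max R S" if "x \<in> Rn1 n" "g x + h x \<noteq> 0" "i \<le> n" for x i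
  proof -
    from that have "g x \<noteq> 0 \<or> h x \<noteq> 0" by auto
    with R[of x i] S[of x i] that show ?thesis by (metis max.coboundedI1 max.coboundedI2)
  qed
  then show ?thesis using assms unfolding Cc_def by (auto intro!: continuous_intros)
qed

text \<open>Tychonoff over all indices: a coordinate above \<open>n\<close> ranges over the
  singleton of \<open>undefined\<close>, so the box is a full product of compact sets.\<close>

lemma compact_box: "compact {x \<in> Rn1 n. \<forall>i\<le>n. \<bar>x i\<bar> \<le> R}"
proof -
  have "{x \<in> Rn1 n. \<forall>i\<le>n. \<bar>x i\<bar> \<le> R}
      = (\<Pi>\<^sub>E i\<in>UNIV. if i \<le> n then {- R..R} else {undefined})"
  proof -
    have "\<bar>y\<bar> \<le> R \<longleftrightarrow> y \<in> {- R..R}" for y by auto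
    then show ?thesis
      by (auto simp: Rn1_def PiE_iff extensional_def simp del: atLeastAtMost_iff split: if_splits)
  qed
  moreover have "compactin euclidean (\<Pi>\<^sub>E i\<in>UNIV. if i \<le> n then {- R..R} else {undefined :: real})"
    unfolding euclidean_product_topology[symmetric]
    by (subst compactin_PiE) auto
  ultimately show ?thesis by simp
qed

text \<open>This links the product sigma-algebra on \<open>{..n}\<close> with the Borel sets of the
  function space over all of \<open>nat\<close>: coordinates above \<open>n\<close> are constant on
  the space.\<close>

lemma measurable_pleb_borel: "(\<lambda>x. x) \<in> borel_measurable (pleb n)"
proof (rule measurable_coordinatewise_then_product)
  fix i
  show "(\<lambda>x. x i) \<in> borel_measurable (pleb n)"
  proof (cases "i \<le> n")
    case True
    then have "(\<lambda>x. x i) \<in> measurable (pleb n) lborel" by (intro measurable_component_singleton) simp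
    then show ?thesis by simp
  next
    case False
    then have "x i = undefined" if "x \<in> space (pleb n)" for x
      using that by (auto simp: space_pleb Rn1_def PiE_iff extensional_def)
    then show ?thesis by (subst measurable_cong[where g = "\<lambda>_. undefined"]) auto
  qed
qed

lemma continuous_borel_measurable_pleb:
  fixes g :: "(nat \<Rightarrow> real) \<Rightarrow> real"
  assumes "continuous_on (Rn1 n) g"
  shows "g \<in> borel_measurable (pleb n)"
proof -
  have "(\<lambda>x. indicator (Rn1 n) x *\<^sub>R g x) \<in> borel_measurable borel"
    using assms closed_Rn1 by (intro borel_measurable_continuous_on_indicator) auto
  then have "(\<lambda>x. indicator (Rn1 n) x *\<^sub>R g x) \<in> borel_measurable (pleb n)"
    using measurable_comp[OF measurable_pleb_borel] by (simp add: comp_def)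
  then show ?thesis by (rule measurable_cong[THEN iffD1, rotated]) (simp add: space_pleb)
qed

lemma Cc_integrable:
  assumes "Cc n g"
  shows "integrable (pleb n) g"
proof -
  interpret product_sigma_finite "\<lambda>_::nat. lborel :: real measure" ..
  obtain R where R: "\<And>x i. x \<in> Rn1 n \<Longrightarrow> g x \<noteq> 0 \<Longrightarrow> i \<le> n \<Longrightarrow> \<bar>x i\<bar> \<le> R"
    and cont: "continuous_on (Rn1 n) g" using assms unfolding Cc_def by blast
  let ?K = "{x \<in> Rn1 n. \<forall>i\<le>n. \<bar>x i\<bar> \<le> R}"
  have "compact (g ` ?K)"
    by (rule compact_continuous_image[OF _ compact_box]) (rule continuous_on_subset[OF cont], auto)
  then obtain B where B: "\<And>x. x \<in> ?K \<Longrightarrow> \<bar>g x\<bar> \<le> B"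
    using compact_imp_bounded[of "g ` ?K"] by (auto simp: bounded_iff)
  have K: "?K = (\<Pi>\<^sub>E i\<in>{..n}. {- R..R})"
  proof -
    have "\<bar>y\<bar> \<le> R \<longleftrightarrow> y \<in> {- R..R}" for y by auto
    then show ?thesis by (auto simp: Rn1_def PiE_iff extensional_def simp del: atLeastAtMost_iff)
  qed
  have "?K \<in> sets (pleb n)" unfolding K by (rule sets_PiM_I_finite) auto
  moreover have "emeasure (pleb n) ?K < \<infinity>"
  proof -
    have "emeasure (pleb n) ?K = (\<Prod>i\<in>{..n}. emeasure lborel {- R..R})"
      unfolding K by (rule emeasure_PiM) auto
    also have "\<dots> < \<infinity>"
      unfolding prod_constant infinity_ennreal_def
      by (intro power_less_top_ennreal[THEN iffD2] disjI1) (simp add: emeasure_lborel_Icc_eq)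
    finally show ?thesis .
  qed
  ultimately have "integrable (pleb n) (\<lambda>x. B * indicator ?K x)"
    by (intro integrable_mult_right integrable_real_indicator)
  then show ?thesis
  proof (rule Bochner_Integration.integrable_bound)
    show "g \<in> borel_measurable (pleb n)" using cont by (rule continuous_borel_measurable_pleb)
    show "AE x in pleb n. norm (g x) \<le> norm (B * indicator ?K x)"
    proof (rule AE_I2)
      fix x assume "x \<in> space (pleb n)"
      then have x: "x \<in> Rn1 n" by (simp add: space_pleb)
      show "norm (g x) \<le> norm (B * indicator ?K x)"
      proof (cases "x \<in> ?K")
        case True
        then show ?thesis using B[OF True] by simp
      next
        case False
        then have "g x = 0" using R x by blast
        then show ?thesis by simp
      qed
    qed
  qed
qed

text \<open>With the variable \<open>i\<close> innermost in Fubini, the inner integral is a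
  difference of two boundary values of \<open>h\<close>, both outside its support.\<close>

lemma integral_derivative_eq_0:
  assumes h: "Cc n h" and h': "Cc n h'" and i: "i \<le> n"
    and deriv: "\<And>x t. x \<in> Rn1 n \<Longrightarrow>
      ((\<lambda>t. h (x(i := t))) has_real_derivative h' (x(i := t))) (at t)"
  shows "(LINT x|pleb n. h' x) = 0"
proof -
  interpret product_sigma_finite "\<lambda>_::nat. lborel :: real measure" ..
  define I where "I = {..n} - {i}"
  have I: "{..n} = insert i I" "finite I" "i \<notin> I" using i by (auto simp: I_def)
  obtain R where R: "\<And>x j. x \<in> Rn1 n \<Longrightarrow> h x \<noteq> 0 \<Longrightarrow> j \<le> n \<Longrightarrow> \<bar>x j\<bar> \<le> R"
    using h unfolding Cc_def by blast
  obtain S where S: "\<And>x j. x \<in> Rn1 n \<Longrightarrow> h' x \<noteq> 0 \<Longrightarrow> j \<le> n \<Longrightarrow> \<bar>x j\<bar> \<le> S"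
    using h' unfolding Cc_def by blast
  \<comment> \<open>The bound \<open>S\<close> keeps the support of \<open>h'\<close> inside the
    interval; the added 1 puts the endpoints strictly beyond the support of
    \<open>h\<close>.\<close>
  define N where "N = max \<bar>R\<bar> \<bar>S\<bar> + 1"
  have "(LINT x|pleb n. h' x) = (\<integral>x. (\<integral>y. h' (x(i := y)) \<partial>lborel) \<partial>Pi\<^sub>M I (\<lambda>_. lborel))"
    unfolding I(1) by (rule product_integral_insert[OF I(2,3)]) (use Cc_integrable[OF h'] I(1) in simp)
  also have "\<dots> = (\<integral>x. 0 \<partial>Pi\<^sub>M I (\<lambda>_. lborel :: real measure))"
  proof (rule Bochner_Integration.integral_cong[OF refl])
    fix x assume "x \<in> space (Pi\<^sub>M I (\<lambda>_. lborel :: real measure))"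
    then have x: "x(i := y) \<in> Rn1 n" for y
      unfolding Rn1_def I(1) by (auto simp: space_PiM PiE_iff extensional_def)
    have "(\<integral>y. h' (x(i := y)) \<partial>lborel) = (\<integral>y. h' (x(i := y)) * indicator {- N..N} y \<partial>lborel)"
    proof (rule Bochner_Integration.integral_cong[OF refl])
      fix y
      show "h' (x(i := y)) = h' (x(i := y)) * indicator {- N..N} y"
        using S[OF x[of y] _ i] by (cases "h' (x(i := y)) = 0") (auto simp: N_def abs_le_iff indicator_def)
    qed
    also have "\<dots> = h (x(i := N)) - h (x(i := - N))"
    proof (rule integral_FTC_Icc_real)
      show "- N \<le> N" by (simp add: N_def)
      show "((\<lambda>y. h (x(i := y))) has_real_derivative h' (x(i := y))) (at y)" for y
        using deriv[OF x[of 0], of y] by simp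
      have "continuous_on UNIV (\<lambda>y. h' (x(i := y)))"
        by (rule continuous_on_compose2[of "Rn1 n" h'])
          ((intro continuous_on_fun_upd continuous_on_const continuous_on_id | use h' x in \<open>auto simp: Cc_def\<close>)+)
      then show "isCont (\<lambda>y. h' (x(i := y))) y" for y
        by (simp add: continuous_on_eq_continuous_at)
    qed
    also have "h (x(i := N)) = 0" using R[OF x[of N] _ i] by (cases "h (x(i := N)) = 0") (auto simp: N_def)
    also have "h (x(i := - N)) = 0" using R[OF x[of "- N"] _ i] by (cases "h (x(i := - N)) = 0") (auto simp: N_def)
    finally show "(\<integral>y. h' (x(i := y)) \<partial>lborel) = 0" by (simp only: diff_zero)
  qed
  finally show ?thesis by simp
qed

section \<open>Scalar test functions, integration by parts and the Poincare inequality\<close>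

definition test_fun :: "nat \<Rightarrow> (nat \<Rightarrow> real) set \<Rightarrow> ((nat \<Rightarrow> real) \<Rightarrow> real) \<Rightarrow> bool" where
  "test_fun n U g \<longleftrightarrow> smooth n g \<and> compact (closure {x \<in> Rn1 n. g x \<noteq> 0}) \<and>
     closure {x \<in> Rn1 n. g x \<noteq> 0} \<subseteq> U"

text \<open>A compact set in this Hausdorff space is closed, so the support closure lies inside
  \<open>K\<close>. Any convenient compact \<open>K\<close> may therefore replace the exact
  support.\<close>

lemma test_funI:
  assumes "smooth n g" "compact K" "K \<subseteq> U" "{x \<in> Rn1 n. g x \<noteq> 0} \<subseteq> K"
  shows "test_fun n U g"
proof -
  have sub: "closure {x \<in> Rn1 n. g x \<noteq> 0} \<subseteq> K"
    using assms by (intro closure_minimal compact_imp_closed)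
  moreover have "compact (closure {x \<in> Rn1 n. g x \<noteq> 0})"
    using compact_Int_closed[OF assms(2) closed_closure[of "{x \<in> Rn1 n. g x \<noteq> 0}"]] sub
    by (simp add: Int_absorb1)
  ultimately show ?thesis using assms by (auto simp: test_fun_def)
qed

lemma test_fun_Cc:
  assumes "test_fun n U g"
  shows "Cc n g"
proof -
  let ?S = "{x \<in> Rn1 n. g x \<noteq> 0}"
  have comp: "compact (closure ?S)" using assms by (simp add: test_fun_def)
  have "\<exists>B. \<forall>x\<in>?S. \<bar>x i\<bar> \<le> B" for i
  proof -
    have "compact ((\<lambda>x. x i) ` closure ?S)"
      by (rule compact_continuous_image[OF _ comp])
        (rule continuous_on_subset[OF continuous_on_product_coordinates subset_UNIV])
    then have "bounded ((\<lambda>x. x i) ` closure ?S)" by (rule compact_imp_bounded)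
    then obtain B where B: "\<forall>y\<in>(\<lambda>x. x i) ` closure ?S. norm y \<le> B"
      unfolding bounded_iff by (rule exE)
    have "\<bar>x i\<bar> \<le> B" if "x \<in> ?S" for x
    proof -
      have "x \<in> closure ?S" using that by (rule closure_subset[THEN subsetD])
      then show ?thesis using B by simp
    qed
    then show ?thesis by blast
  qed
  then obtain B where B: "\<And>i x. x \<in> ?S \<Longrightarrow> \<bar>x i\<bar> \<le> B i" by metis
  have "\<bar>x i\<bar> \<le> Max (B ` {..n})" if "x \<in> Rn1 n" "g x \<noteq> 0" "i \<le> n" for x i
    using B[of x i] that by (intro order_trans[OF _ Max_ge]) auto
  then show ?thesis using assms unfolding Cc_def test_fun_def by (blast intro: smooth_continuous)
qed

lemma in_closure_support: "x \<in> Rn1 n \<Longrightarrow> g x \<noteq> 0 \<Longrightarrow> x \<in> closure {x \<in> Rn1 n. g x \<noteq> 0}"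
  by (rule subsetD[OF closure_subset]) simp

lemma test_fun_lincomb:
  assumes g: "test_fun n U g" and h: "test_fun n U h"
  shows "test_fun n U (\<lambda>x. s * g x + t * h x)"
proof (rule test_funI)
  show "smooth n (\<lambda>x. s * g x + t * h x)"
    using assms by (auto simp: test_fun_def intro: smooth_lincomb)
  let ?K = "closure {x \<in> Rn1 n. g x \<noteq> 0} \<union> closure {x \<in> Rn1 n. h x \<noteq> 0}"
  show "compact ?K" "?K \<subseteq> U" using assms by (auto simp: test_fun_def)
  show "{x \<in> Rn1 n. s * g x + t * h x \<noteq> 0} \<subseteq> ?K"
  proof
    fix x assume x: "x \<in> {x \<in> Rn1 n. s * g x + t * h x \<noteq> 0}"
    then have "x \<in> Rn1 n" "g x \<noteq> 0 \<or> h x \<noteq> 0" by auto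
    then show "x \<in> ?K" using in_closure_support[of x n g] in_closure_support[of x n h] by (elim disjE) auto
  qed
qed

lemma test_fun_zero: "test_fun n U (\<lambda>_. 0)"
proof -
  have p: "partial i (\<lambda>_. 0) = (\<lambda>_. 0)" for i by (simp add: partial_def fun_eq_iff)
  have "foldr partial js (\<lambda>_. 0) = (\<lambda>_. 0)" for js by (induction js) (simp_all add: p)
  then show ?thesis by (simp add: test_fun_def smooth_def)
qed

lemma test_fun_sum:
  "(\<And>i. i \<in> S \<Longrightarrow> test_fun n U (g i)) \<Longrightarrow> test_fun n U (\<lambda>x. \<Sum>i\<in>S. c i * g i x)"
proof (induction S rule: infinite_finite_induct)
  case (insert i S)
  then show ?case using test_fun_lincomb[of n U "g i" "\<lambda>x. \<Sum>i\<in>S. c i * g i x" "c i" 1] by simp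
qed (simp_all add: test_fun_zero)

text \<open>Differentiation does not enlarge the support: from a point off the closed support the
  function vanishes on an open piece of the coordinate line, so its derivative is zero
  there.\<close>

lemma test_fun_partial:
  assumes g: "test_fun n U g" and i: "i \<le> n"
  shows "test_fun n U (partial i g)"
proof (rule test_funI)
  let ?K = "closure {x \<in> Rn1 n. g x \<noteq> 0}"
  show "smooth n (partial i g)" using assms by (auto simp: test_fun_def intro: smooth_partial)
  show "compact ?K" "?K \<subseteq> U" using g by (auto simp: test_fun_def)
  have "partial i g x = 0" if x: "x \<in> Rn1 n" "x \<notin> ?K" for x
  proof (rule partial_eqI)
    have "open ((\<lambda>t. x(i := t)) -` (- ?K))"
      by (intro open_vimage continuous_on_fun_upd continuous_on_const continuous_on_id) auto
    moreover have "x i \<in> (\<lambda>t. x(i := t)) -` (- ?K)" using x by simp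
    moreover have "0 = g (x(i := t))" if "t \<in> (\<lambda>t. x(i := t)) -` (- ?K)" for t
      using that in_closure_support[of "x(i := t)" n g] fun_upd_in_Rn1[OF x(1) i, of t] by auto
    ultimately show "((\<lambda>t. g (x(i := t))) has_real_derivative 0) (at (x i))"
      by (intro has_field_derivative_transform_within_open[OF DERIV_const[of "0::real"]])
  qed
  then show "{x \<in> Rn1 n. partial i g x \<noteq> 0} \<subseteq> ?K" by auto
qed

lemma test_fun_smooth: "test_fun n U g \<Longrightarrow> smooth n g"
  by (simp add: test_fun_def)

lemma test_fun_continuous: "test_fun n U g \<Longrightarrow> continuous_on (Rn1 n) g"
  by (simp add: test_fun_smooth smooth_continuous)

lemma test_fun_zero_outside: "test_fun n U g \<Longrightarrow> x \<in> Rn1 n \<Longrightarrow> x \<notin> U \<Longrightarrow> g x = 0"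
  using in_closure_support[of x n g] unfolding test_fun_def by auto

lemma test_fun_mult_integrable:
  assumes "test_fun n U g" "test_fun n U h"
  shows "integrable (pleb n) (\<lambda>x. g x * h x)"
  using assms by (intro Cc_integrable Cc_mult test_fun_Cc test_fun_continuous)

lemma integral_partial_mult:
  assumes g: "test_fun n U g" and h: "test_fun n U h" and i: "i \<le> n"
  shows "(LINT x|pleb n. partial i g x * h x) = - (LINT x|pleb n. g x * partial i h x)"
proof -
  note t = g h test_fun_partial[OF g i] test_fun_partial[OF h i]
  note k = t[THEN test_fun_Cc] t[THEN test_fun_continuous]
  have "(LINT x|pleb n. partial i g x * h x + g x * partial i h x) = 0"
  proof (rule integral_derivative_eq_0[OF _ _ i])
    show "Cc n (\<lambda>x. g x * h x)"
      by (intro Cc_mult k)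
    show "Cc n (\<lambda>x. partial i g x * h x + g x * partial i h x)"
      by (intro Cc_add Cc_mult k)
    fix x t assume "x \<in> Rn1 n"
    then show "((\<lambda>t. g (x(i := t)) * h (x(i := t))) has_real_derivative
        partial i g (x(i := t)) * h (x(i := t)) + g (x(i := t)) * partial i h (x(i := t))) (at t)"
      using smooth_has_partial[OF test_fun_smooth[OF g] i] smooth_has_partial[OF test_fun_smooth[OF h] i]
      by (auto intro!: derivative_eq_intros)
  qed
  then show ?thesis
    by (subst (asm) Bochner_Integration.integral_add) (auto intro: test_fun_mult_integrable t)
qed

text \<open>Two integrations by parts, with the commutation of mixed derivatives in between. The
  cancellation of the cross terms rests on this identity.\<close>

lemma integral_partial_swap:
  assumes g: "test_fun n U g" and h: "test_fun n U h" and i: "i \<le> n" and j: "j \<le> n"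
  shows "(LINT x|pleb n. partial i g x * partial j h x) = (LINT x|pleb n. partial j g x * partial i h x)"
proof -
  have "(LINT x|pleb n. g x * partial i (partial j h) x) = (LINT x|pleb n. g x * partial j (partial i h) x)"
    using partial_commute[OF test_fun_smooth[OF h] i j]
    by (intro Bochner_Integration.integral_cong) (auto simp: space_pleb)
  then show ?thesis
    by (simp add: integral_partial_mult[OF g test_fun_partial[OF h j] i]
        integral_partial_mult[OF g test_fun_partial[OF h i] j])
qed

text \<open>The derivative of \<open>(x 0 - a) * (g x)\<^sup>2\<close> in \<open>x 0\<close> has
  integral zero, which trades \<open>g\<^sup>2\<close> for a product of \<open>g\<close> with
  \<open>(x 0 - a) * partial 0 g x\<close>. On the strip the weight is at most \<open>b - a\<close>;
  elsewhere \<open>g\<close> vanishes.\<close>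

lemma integral_poincare:
  assumes g: "test_fun n (Omega0_int n a b) g"
  shows "(LINT x|pleb n. (g x)\<^sup>2) \<le> 4 * (b - a)\<^sup>2 * (LINT x|pleb n. (partial 0 g x)\<^sup>2)"
proof -
  note t = g test_fun_partial[OF g le0]
  note k = t[THEN test_fun_Cc] t[THEN test_fun_continuous]
  have c: "continuous_on (Rn1 n) (\<lambda>x. x 0 - a)"
    by (intro continuous_intros continuous_on_subset[OF continuous_on_product_coordinates subset_UNIV])
  let ?h = "\<lambda>x. (g x)\<^sup>2 + g x * (2 * ((x 0 - a) * partial 0 g x))"
  have Cc2: "Cc n (\<lambda>x. (g x)\<^sup>2)" "Cc n (\<lambda>x. (partial 0 g x)\<^sup>2)"
    unfolding power2_eq_square by (intro Cc_mult k)+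
  have "Cc n (\<lambda>x. g x * (2 * ((x 0 - a) * partial 0 g x)))"
    by (intro Cc_mult continuous_on_mult continuous_on_const c k)
  from Cc_add[OF Cc2(1) this] have Cch: "Cc n ?h" .
  have zero: "(LINT x|pleb n. ?h x) = 0"
  proof (rule integral_derivative_eq_0)
    show "Cc n (\<lambda>x. (g x)\<^sup>2 * (x 0 - a))" by (intro Cc_mult Cc2 c)
    fix x :: "nat \<Rightarrow> real" and s :: real assume x: "x \<in> Rn1 n"
    have "((\<lambda>t. (g (x(0 := t)))\<^sup>2 * (t - a)) has_real_derivative
       (g (x(0 := s)))\<^sup>2 + g (x(0 := s)) * (2 * ((s - a) * partial 0 g (x(0 := s))))) (at s)"
      by (rule derivative_eq_intros smooth_has_partial[OF test_fun_smooth[OF g] le0 x] refl)+ simp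
    then show "((\<lambda>t. (g (x(0 := t)))\<^sup>2 * ((x(0 := t)) 0 - a)) has_real_derivative
       ?h (x(0 := s))) (at s)" by simp
  qed (use Cch in auto)
  have "(LINT x|pleb n. 1/2 * (g x)\<^sup>2) \<le> (LINT x|pleb n. ?h x + 2 * (b - a)\<^sup>2 * (partial 0 g x)\<^sup>2)"
  proof (rule integral_mono)
    show "integrable (pleb n) (\<lambda>x. 1/2 * (g x)\<^sup>2)"
      "integrable (pleb n) (\<lambda>x. ?h x + 2 * (b - a)\<^sup>2 * (partial 0 g x)\<^sup>2)"
      using Cc_integrable[OF Cc2(1)] Cc_integrable[OF Cc2(2)] Cc_integrable[OF Cch] by auto
    fix x assume "x \<in> space (pleb n)"
    then have x: "x \<in> Rn1 n" by (simp add: space_pleb)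
    show "1/2 * (g x)\<^sup>2 \<le> ?h x + 2 * (b - a)\<^sup>2 * (partial 0 g x)\<^sup>2"
    proof (cases "x \<in> Omega0_int n a b")
      case False
      then show ?thesis using test_fun_zero_outside[OF g x] by simp
    next
      case True
      then have r: "(x 0 - a)\<^sup>2 \<le> (b - a)\<^sup>2"
        by (auto simp: Omega0_int_def intro!: power_mono)
      define q where "q = (x 0 - a) * partial 0 g x"
      \<comment> \<open>Half of this square absorbs the product at the price of
        \<open>1/2 * (g x)\<^sup>2\<close> and \<open>2 * q\<^sup>2\<close>; multiplying by 2 at the
        end gives the constant 4.\<close>
      have "0 \<le> (g x + 2 * q)\<^sup>2" by simp
      also have "\<dots> = (g x)\<^sup>2 + 4 * (g x * q) + 4 * q\<^sup>2"
        by (simp add: power2_eq_square algebra_simps)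
      finally have "1/2 * (g x)\<^sup>2 \<le> ?h x + 2 * q\<^sup>2"
        unfolding q_def[symmetric] by simp
      also have "q\<^sup>2 = (x 0 - a)\<^sup>2 * (partial 0 g x)\<^sup>2" by (simp add: q_def power_mult_distrib)
      also have "(x 0 - a)\<^sup>2 * (partial 0 g x)\<^sup>2 \<le> (b - a)\<^sup>2 * (partial 0 g x)\<^sup>2"
        using r by (rule mult_right_mono) simp
      finally show ?thesis by simp
    qed
  qed
  also have "\<dots> = (LINT x|pleb n. ?h x) + 2 * (b - a)\<^sup>2 * (LINT x|pleb n. (partial 0 g x)\<^sup>2)"
    using Cc_integrable[OF Cc2(2)] Cc_integrable[OF Cch] by simp
  finally show ?thesis using zero by simp
qed

lemma integral_sum_sum:
  fixes f :: "'i \<Rightarrow> 'j \<Rightarrow> 'a \<Rightarrow> real"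
  assumes "\<And>i j. i \<in> I \<Longrightarrow> j \<in> J \<Longrightarrow> integrable M (f i j)"
  shows "(LINT x|M. (\<Sum>i\<in>I. \<Sum>j\<in>J. f i j x)) = (\<Sum>i\<in>I. \<Sum>j\<in>J. LINT x|M. f i j x)"
proof -
  have "(LINT x|M. (\<Sum>i\<in>I. \<Sum>j\<in>J. f i j x)) = (\<Sum>i\<in>I. LINT x|M. (\<Sum>j\<in>J. f i j x))"
    by (intro Bochner_Integration.integral_sum Bochner_Integration.integrable_sum assms)
  also have "\<dots> = (\<Sum>i\<in>I. \<Sum>j\<in>J. LINT x|M. f i j x)"
    by (intro sum.cong refl Bochner_Integration.integral_sum assms)
  finally show ?thesis .
qed


section \<open>The energy identity in the Clifford algebra\<close>

lemma cliff_sign_square: "cliff_sign A B * cliff_sign A B = 1"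
  unfolding cliff_sign_def by (auto simp: prod.distrib[symmetric] intro!: prod.neutral)

lemma sym_diff_commute: "sym_diff A B = sym_diff B A"
  by auto

lemma blade_in_Cl:
  assumes "C \<subseteq> {1..n}"
  shows "blade C \<in> Cl n"
proof -
  have "finite C" "0 \<notin> C" using assms by (auto intro: finite_subset)
  then show ?thesis using assms by (auto simp: Cl_def coef_blade split: if_splits)
qed

text \<open>Left multiplication by a basis element permutes the coordinates up to sign. So it
  preserves test functions and can move any coefficient to the scalar position.\<close>

lemma coef_blade_mult:
  assumes C: "C \<subseteq> {1..n}"
  shows "coef (blade C * b) D = cliff_sign C (sym_diff C D) * coef b (sym_diff C D)"
proof -
  have C': "finite C" "0 \<notin> C" using C by (auto intro: finite_subset)
  have "coef (blade C * b) D
      = (\<Sum>A\<in>Pow {1..n}. if A = C then cliff_sign C (sym_diff C D) * coef b (sym_diff C D) else 0)"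
    unfolding coef_mult[OF blade_in_Cl[OF C]]
    by (intro sum.cong refl) (simp add: coef_blade[OF C'] del: Un_iff)
  also have "\<dots> = cliff_sign C (sym_diff C D) * coef b (sym_diff C D)"
    using C by (subst sum.delta) auto
  finally show ?thesis .
qed

lemma coef_mult_gen:
  assumes a: "a \<in> Cl n" and i: "1 \<le> i"
  shows "coef (a * gen i) D = cliff_sign (sym_diff {i} D) {i} * coef a (sym_diff {i} D)"
proof -
  have eq: "sym_diff A D = {i} \<longleftrightarrow> A = sym_diff {i} D" for A
    unfolding sym_diff_commute[of A D] sym_diff_eq_iff by (simp only: sym_diff_commute[of D "{i}"])
  have "coef (a * gen i) D = (\<Sum>A\<in>Pow {1..n}. if A = sym_diff {i} D
      then cliff_sign (sym_diff {i} D) {i} * coef a (sym_diff {i} D) else 0)"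
    unfolding coef_mult[OF a]
  proof (rule sum.cong[OF refl])
    fix A
    show "cliff_sign A (sym_diff A D) * (coef a A * coef (gen i) (sym_diff A D)) =
      (if A = sym_diff {i} D then cliff_sign (sym_diff {i} D) {i} * coef a (sym_diff {i} D) else 0)"
    proof (cases "A = sym_diff {i} D")
      case True
      then have "sym_diff A D = {i}" using eq by blast
      then show ?thesis using True i by (simp only: gen.rep_eq) simp
    next
      case False
      then have "sym_diff A D \<noteq> {i}" using eq by blast
      then show ?thesis using False i by (simp only: gen.rep_eq) simp
    qed
  qed
  also have "\<dots> = cliff_sign (sym_diff {i} D) {i} * coef a (sym_diff {i} D)"
  proof -
    have "(\<Sum>A\<in>Pow {1..n}. if A = B then s * coef a B else 0) = s * coef a B" for B s
      by (cases "B \<subseteq> {1..n}") (simp_all add: ClD[OF a])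
    then show ?thesis .
  qed
  finally show ?thesis .
qed

text \<open>The Euclidean pairing without the weight \<open>2 ^ n\<close> of \<open>norm0\<close>;
  the weight is restored on both sides of the final estimate.\<close>

definition cinner :: "nat \<Rightarrow> cliff \<Rightarrow> cliff \<Rightarrow> real" where
  "cinner n a b = (\<Sum>A\<in>Pow {1..n}. coef a A * coef b A)"

lemma cinner_commute: "cinner n a b = cinner n b a"
  by (simp add: cinner_def mult.commute)

lemma cinner_minus_left: "cinner n (- a) b = - cinner n a b"
  by (simp add: cinner_def sum_negf)

lemma cinner_scaleR_left: "cinner n (r *\<^sub>R a) b = r * cinner n a b"
  by (simp add: cinner_def sum_distrib_left mult_ac)

lemma cinner_sum_left: "cinner n (sum f S) b = (\<Sum>x\<in>S. cinner n (f x) b)"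
  unfolding cinner_def coef_sum sum_distrib_right by (rule sum.swap)

lemma cinner_sum_right: "cinner n a (sum f S) = (\<Sum>x\<in>S. cinner n a (f x))"
  by (simp add: cinner_commute[of n a] cinner_sum_left)

lemma cinner_scaleR_right: "cinner n a (r *\<^sub>R b) = r * cinner n a b"
  by (simp add: cinner_commute[of n a] cinner_scaleR_left)

text \<open>Skew-adjointness of right multiplication by a generator: reindexing by the symmetric
  difference with \<open>{i}\<close> moves the factor across, and the sign comes from
  \<open>cliff_sign {i} {i} = -1\<close>, that is from the square of the generator.\<close>

lemma cinner_mult_gen_left:
  assumes a: "a \<in> Cl n" and b: "b \<in> Cl n" and i: "1 \<le> i" "i \<le> n"
  shows "cinner n (a * gen i) b = - cinner n a (b * gen i)"
proof -
  let ?f = "\<lambda>D. cliff_sign (sym_diff {i} D) {i} * coef a (sym_diff {i} D) * coef b D"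
  have "cinner n (a * gen i) b = (\<Sum>D\<in>Pow {1..n}. ?f D)"
    unfolding cinner_def coef_mult_gen[OF a i(1)] ..
  also have "\<dots> = (\<Sum>D\<in>Pow {1..n}. ?f (sym_diff {i} D))"
    using i by (intro sum_sym_diff_reindex[symmetric]) simp
  also have "\<dots> = (\<Sum>D\<in>Pow {1..n}. - (coef a D * coef (b * gen i) D))"
  proof (rule sum.cong[OF refl])
    fix D assume "D \<in> Pow {1..n}"
    then have "finite D" by (auto intro: finite_subset)
    then have s: "cliff_sign (sym_diff {i} D) {i} = - cliff_sign D {i}"
      using cliff_sign_sym_diff_left[of "{i}" D "{i}"] by (simp add: cliff_sign_def)
    show "?f (sym_diff {i} D) = - (coef a D * coef (b * gen i) D)"
      unfolding sym_diff_cancel coef_mult_gen[OF b i(1)] s by (simp only: mult_ac mult_minus_left mult_minus_right minus_minus)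
  qed
  finally show ?thesis by (simp add: cinner_def sum_negf)
qed

text \<open>A skew-adjoint map with square -1 is orthogonal; for \<open>i = 0\<close> the map is the
  identity.\<close>

lemma cinner_mult_gen_same:
  assumes a: "a \<in> Cl n" and b: "b \<in> Cl n" and i: "i \<le> n"
  shows "cinner n (a * gen i) (b * gen i) = cinner n a b"
proof (cases "i = 0")
  case False
  then have i1: "1 \<le> i" by simp
  have "cinner n (a * gen i) (b * gen i) = - cinner n a (b * gen i * gen i)"
    by (rule cinner_mult_gen_left[OF a Cl_mult[OF b gen_in_Cl[OF i]] i1 i])
  also have "b * gen i * gen i = - b" by (simp add: mult.assoc gen_square[OF i1])
  finally show ?thesis by (simp add: cinner_commute[of n a] cinner_minus_left)
qed (simp add: gen_0)

text \<open>For positive indices, skew-adjointness puts both generators on one side, where they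
  anticommute. If one index is 0, the claim is skew-adjointness itself.\<close>

lemma cinner_mult_gen_swap:
  assumes a: "a \<in> Cl n" and b: "b \<in> Cl n" and i: "i \<le> n" and j: "j \<le> n" and ij: "i \<noteq> j"
  shows "cinner n (a * gen i) (b * gen j) = - cinner n (a * gen j) (b * gen i)"
proof -
  consider "i = 0" "1 \<le> j" | "j = 0" "1 \<le> i" | "1 \<le> i" "1 \<le> j" using ij by linarith
  then show ?thesis
  proof cases
    case 1
    then show ?thesis using cinner_mult_gen_left[OF a b _ j] by (simp add: gen_0)
  next
    case 2
    then show ?thesis using cinner_mult_gen_left[OF a b _ i] by (simp add: gen_0)
  next
    case 3
    have bi: "b * gen i \<in> Cl n" and bj: "b * gen j \<in> Cl n"
      by (intro Cl_mult b gen_in_Cl i j)+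
    have "gen j * gen i = - (gen i * gen j)"
      using gen_anticommute[OF 3 ij] by (simp add: eq_neg_iff_add_eq_0 add.commute)
    then have "b * gen j * gen i = - (b * gen i * gen j)" by (simp add: mult.assoc)
    then show ?thesis
      unfolding cinner_mult_gen_left[OF a bj 3(1) i] cinner_mult_gen_left[OF a bi 3(2) j]
      by (simp add: cinner_commute[of n a] cinner_minus_left)
  qed
qed

lemma norm0_square: "(norm0 n a)\<^sup>2 = 2 ^ n * (\<Sum>A\<in>Pow {1..n}. (coef a A)\<^sup>2)"
  unfolding norm0_def by (intro real_sqrt_pow2 mult_nonneg_nonneg sum_nonneg) auto

section \<open>Algebra-valued test functions and the energy of \<open>Dbar_right\<close>\<close>

definition cliff_partial :: "nat \<Rightarrow> nat \<Rightarrow> ((nat \<Rightarrow> real) \<Rightarrow> cliff) \<Rightarrow> (nat \<Rightarrow> real) \<Rightarrow> cliff" where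
  "cliff_partial n i \<alpha> x = (\<Sum>A\<in>Pow {1..n}. partial i (\<lambda>y. coef (\<alpha> y) A) x *\<^sub>R blade A)"

lemma Cl_sum: "(\<And>x. x \<in> S \<Longrightarrow> f x \<in> Cl n) \<Longrightarrow> sum f S \<in> Cl n"
proof (induction S rule: infinite_finite_induct)
  case (insert x S)
  then show ?case by (simp add: Cl_add)
qed (simp_all add: Cl_def)

lemma coef_blade_sum:
  assumes "A \<subseteq> {1..n}"
  shows "coef (\<Sum>B\<in>Pow {1..n}. h B *\<^sub>R blade B) A = h A"
proof -
  have "coef (\<Sum>B\<in>Pow {1..n}. h B *\<^sub>R blade B) A = (\<Sum>B\<in>Pow {1..n}. if A = B then h B else 0)"
    unfolding coef_sum
  proof (rule sum.cong[OF refl])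
    fix B assume "B \<in> Pow {1..n}"
    then have "finite B" "0 \<notin> B" by (auto intro: finite_subset)
    then show "coef (h B *\<^sub>R blade B) A = (if A = B then h B else 0)" by (simp add: coef_blade)
  qed
  also have "\<dots> = h A" using assms by (subst sum.delta') auto
  finally show ?thesis .
qed

lemma blade_sum_in_Cl: "(\<Sum>B\<in>Pow {1..n}. h B *\<^sub>R blade B) \<in> Cl n"
  by (intro Cl_sum Cl_scaleR blade_in_Cl) auto

lemma cliff_partial_in_Cl: "cliff_partial n i \<alpha> x \<in> Cl n"
  unfolding cliff_partial_def by (rule blade_sum_in_Cl)

lemma coef_cliff_partial: "A \<subseteq> {1..n} \<Longrightarrow> coef (cliff_partial n i \<alpha> x) A = partial i (\<lambda>y. coef (\<alpha> y) A) x"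
  unfolding cliff_partial_def by (rule coef_blade_sum)

lemma Dbar_right_eq_sum_cliff_partial: "Dbar_right n \<alpha> x = (\<Sum>i\<in>{..n}. cliff_partial n i \<alpha> x * gen i)"
  by (simp add: Dbar_right_def cliff_partial_def sum_distrib_right)

lemma Dbar_right_in_Cl: "Dbar_right n \<alpha> x \<in> Cl n"
  unfolding Dbar_right_eq_sum_cliff_partial by (intro Cl_sum Cl_mult cliff_partial_in_Cl gen_in_Cl) simp

lemma Cl_eqI:
  assumes "a \<in> Cl n" "b \<in> Cl n" "\<And>A. A \<subseteq> {1..n} \<Longrightarrow> coef a A = coef b A"
  shows "a = b"
  using assms by (intro cliff_eqI) (metis ClD)

lemma C0_infty_iff:
  "\<alpha> \<in> C0_infty n U \<longleftrightarrow> (\<forall>x\<in>Rn1 n. \<alpha> x \<in> Cl n) \<and>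
     (\<forall>A. A \<subseteq> {1..n} \<longrightarrow> test_fun n U (\<lambda>x. coef (\<alpha> x) A))"
  by (simp add: C0_infty_def test_fun_def Ball_def)

lemma C0_infty_test_fun:
  "\<alpha> \<in> C0_infty n U \<Longrightarrow> A \<subseteq> {1..n} \<Longrightarrow> test_fun n U (\<lambda>x. coef (\<alpha> x) A)"
  by (simp add: C0_infty_iff)

lemma C0_infty_lincomb:
  assumes "\<alpha> \<in> C0_infty n U" "\<beta> \<in> C0_infty n U"
  shows "(\<lambda>x. s *\<^sub>R \<alpha> x + t *\<^sub>R \<beta> x) \<in> C0_infty n U"
  using assms by (auto simp: C0_infty_iff intro!: Cl_add Cl_scaleR test_fun_lincomb)

lemma cliff_partial_lincomb:
  assumes "\<alpha> \<in> C0_infty n U" "\<beta> \<in> C0_infty n U" "x \<in> Rn1 n" "i \<le> n"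
  shows "cliff_partial n i (\<lambda>x. s *\<^sub>R \<alpha> x + t *\<^sub>R \<beta> x) x = s *\<^sub>R cliff_partial n i \<alpha> x + t *\<^sub>R cliff_partial n i \<beta> x"
proof (rule Cl_eqI)
  fix A assume A: "A \<subseteq> {1..n}"
  show "coef (cliff_partial n i (\<lambda>x. s *\<^sub>R \<alpha> x + t *\<^sub>R \<beta> x) x) A = coef (s *\<^sub>R cliff_partial n i \<alpha> x + t *\<^sub>R cliff_partial n i \<beta> x) A"
    using partial_lincomb[OF test_fun_smooth[OF C0_infty_test_fun[OF assms(1) A]]
        test_fun_smooth[OF C0_infty_test_fun[OF assms(2) A]] assms(3,4), of s t]
    by (simp add: coef_cliff_partial[OF A])
qed (intro Cl_add Cl_scaleR cliff_partial_in_Cl)+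

lemma Dbar_right_lincomb:
  assumes "\<alpha> \<in> C0_infty n U" "\<beta> \<in> C0_infty n U" "x \<in> Rn1 n"
  shows "Dbar_right n (\<lambda>x. s *\<^sub>R \<alpha> x + t *\<^sub>R \<beta> x) x = s *\<^sub>R Dbar_right n \<alpha> x + t *\<^sub>R Dbar_right n \<beta> x"
proof -
  have "Dbar_right n (\<lambda>x. s *\<^sub>R \<alpha> x + t *\<^sub>R \<beta> x) x
      = (\<Sum>i\<in>{..n}. s *\<^sub>R (cliff_partial n i \<alpha> x * gen i) + t *\<^sub>R (cliff_partial n i \<beta> x * gen i))"
    unfolding Dbar_right_eq_sum_cliff_partial
    by (intro sum.cong refl) (simp add: cliff_partial_lincomb[OF assms] distrib_right)
  then show ?thesis by (simp add: Dbar_right_eq_sum_cliff_partial sum.distrib scaleR_sum_right)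
qed

lemma sym_diff_subset: "A \<subseteq> S \<Longrightarrow> B \<subseteq> S \<Longrightarrow> sym_diff A B \<subseteq> S"
  by blast

lemma C0_infty_blade_mult:
  assumes \<alpha>: "\<alpha> \<in> C0_infty n U" and C: "C \<subseteq> {1..n}"
  shows "(\<lambda>x. blade C * \<alpha> x) \<in> C0_infty n U"
  unfolding C0_infty_iff
proof (intro conjI allI impI ballI)
  show "blade C * \<alpha> x \<in> Cl n" if "x \<in> Rn1 n" for x
    using \<alpha> that by (intro Cl_mult blade_in_Cl[OF C]) (simp add: C0_infty_iff)
  fix A assume A: "A \<subseteq> {1..n}"
  have "test_fun n U (\<lambda>x. coef (\<alpha> x) (sym_diff C A))"
    by (rule C0_infty_test_fun[OF \<alpha> sym_diff_subset[OF C A]])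
  \<comment> \<open>Scaling by the sign, written as a linear combination with second coefficient
    0.\<close>
  from test_fun_lincomb[OF this this, of "cliff_sign C (sym_diff C A)" 0]
  show "test_fun n U (\<lambda>x. coef (blade C * \<alpha> x) A)"
    unfolding coef_blade_mult[OF C] by (simp only: mult_zero_left add_0_right)
qed

text \<open>The generators act from the right, so by associativity a constant left factor passes
  through; the derivatives only see its signed permutation of coordinates.\<close>

lemma Dbar_right_blade_mult:
  assumes \<alpha>: "\<alpha> \<in> C0_infty n U" and C: "C \<subseteq> {1..n}" and x: "x \<in> Rn1 n"
  shows "Dbar_right n (\<lambda>x. blade C * \<alpha> x) x = blade C * Dbar_right n \<alpha> x"
proof -
  have "cliff_partial n i (\<lambda>x. blade C * \<alpha> x) x = blade C * cliff_partial n i \<alpha> x" if i: "i \<le> n" for i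
  proof (rule Cl_eqI)
    fix A assume A: "A \<subseteq> {1..n}"
    let ?s = "cliff_sign C (sym_diff C A)"
    note CA = sym_diff_subset[OF C A]
    have sm: "smooth n (\<lambda>x. coef (\<alpha> x) (sym_diff C A))"
      by (rule test_fun_smooth[OF C0_infty_test_fun[OF \<alpha> CA]])
    have "partial i (\<lambda>y. ?s * coef (\<alpha> y) (sym_diff C A)) x = ?s * partial i (\<lambda>y. coef (\<alpha> y) (sym_diff C A)) x"
      using partial_lincomb[OF sm sm x i, of ?s 0] by (simp only: mult_zero_left add_0_right)
    then show "coef (cliff_partial n i (\<lambda>x. blade C * \<alpha> x) x) A = coef (blade C * cliff_partial n i \<alpha> x) A"
      unfolding coef_blade_mult[OF C] coef_cliff_partial[OF A] coef_cliff_partial[OF CA] .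
  qed (intro Cl_mult blade_in_Cl[OF C] cliff_partial_in_Cl)+
  then show ?thesis by (simp add: Dbar_right_eq_sum_cliff_partial sum_distrib_left mult.assoc)
qed

lemma test_fun_coef_Dbar_right:
  assumes \<alpha>: "\<alpha> \<in> C0_infty n U"
  shows "test_fun n U (\<lambda>x. coef (Dbar_right n \<alpha> x) A)"
proof -
  have "(\<lambda>x. coef (Dbar_right n \<alpha> x) A) = (\<lambda>x. \<Sum>(i, B)\<in>{..n} \<times> Pow {1..n}.
      coef (blade B * gen i) A * partial i (\<lambda>y. coef (\<alpha> y) B) x)"
    unfolding Dbar_right_def by (simp add: coef_sum sum.cartesian_product mult.commute case_prod_beta)
  moreover have "test_fun n U (\<lambda>x. \<Sum>p\<in>{..n} \<times> Pow {1..n}.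
      coef (blade (snd p) * gen (fst p)) A * partial (fst p) (\<lambda>y. coef (\<alpha> y) (snd p)) x)"
    by (rule test_fun_sum) (auto intro!: test_fun_partial C0_infty_test_fun[OF \<alpha>])
  ultimately show ?thesis by (simp add: case_prod_beta)
qed

text \<open>Separates algebra from analysis: \<open>c\<close> and \<open>d\<close> enter only
  constant coefficients, and the derivatives only scalar products.\<close>

lemma cinner_cliff_partial_expand:
  "cinner n (cliff_partial n i \<alpha> x * c) (cliff_partial n j \<alpha> x * d)
    = (\<Sum>A\<in>Pow {1..n}. \<Sum>B\<in>Pow {1..n}. cinner n (blade A * c) (blade B * d) *
        (partial i (\<lambda>y. coef (\<alpha> y) A) x * partial j (\<lambda>y. coef (\<alpha> y) B) x))"
  by (simp add: cliff_partial_def sum_distrib_right cinner_sum_left cinner_sum_right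
      cinner_scaleR_left cinner_scaleR_right sum_distrib_left mult_ac) (rule sum.swap)

lemma integrable_cinner_cliff_partial:
  assumes \<alpha>: "\<alpha> \<in> C0_infty n U" and "i \<le> n" "j \<le> n"
  shows "integrable (pleb n) (\<lambda>x. cinner n (cliff_partial n i \<alpha> x * c) (cliff_partial n j \<alpha> x * d))"
  unfolding cinner_cliff_partial_expand
  by (intro Bochner_Integration.integrable_sum integrable_mult_right
      test_fun_mult_integrable[where U = U] test_fun_partial C0_infty_test_fun[OF \<alpha>]) (use assms in auto)

lemma integral_cinner_cliff_partial:
  assumes \<alpha>: "\<alpha> \<in> C0_infty n U" and i: "i \<le> n" and j: "j \<le> n"
  shows "(LINT x|pleb n. cinner n (cliff_partial n i \<alpha> x * c) (cliff_partial n j \<alpha> x * d))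
    = (\<Sum>A\<in>Pow {1..n}. \<Sum>B\<in>Pow {1..n}. cinner n (blade A * c) (blade B * d) *
        (LINT x|pleb n. partial i (\<lambda>y. coef (\<alpha> y) A) x * partial j (\<lambda>y. coef (\<alpha> y) B) x))"
proof -
  have int: "integrable (pleb n) (\<lambda>x. partial i (\<lambda>y. coef (\<alpha> y) A) x * partial j (\<lambda>y. coef (\<alpha> y) B) x)"
    if "A \<in> Pow {1..n}" "B \<in> Pow {1..n}" for A B
    using that i j by (intro test_fun_mult_integrable[where U = U] test_fun_partial C0_infty_test_fun[OF \<alpha>]) auto
  show ?thesis
    unfolding cinner_cliff_partial_expand
    unfolding integral_mult_right_zero[symmetric]
    by (intro integral_sum_sum integrable_mult_right int)
qed

text \<open>Only the derivatives change places while \<open>c\<close> and \<open>d\<close> stay.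
  Combined with the antisymmetry in the generators, this makes an off-diagonal term the negative of
  its transpose.\<close>

lemma integral_cinner_cliff_partial_swap:
  assumes \<alpha>: "\<alpha> \<in> C0_infty n U" and i: "i \<le> n" and j: "j \<le> n"
  shows "(LINT x|pleb n. cinner n (cliff_partial n i \<alpha> x * c) (cliff_partial n j \<alpha> x * d))
    = (LINT x|pleb n. cinner n (cliff_partial n j \<alpha> x * c) (cliff_partial n i \<alpha> x * d))"
  unfolding integral_cinner_cliff_partial[OF \<alpha> i j] integral_cinner_cliff_partial[OF \<alpha> j i]
proof (intro sum.cong refl)
  fix A B assume AB: "A \<in> Pow {1..n}" "B \<in> Pow {1..n}"
  have "test_fun n U (\<lambda>y. coef (\<alpha> y) A)" "test_fun n U (\<lambda>y. coef (\<alpha> y) B)"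
    using AB C0_infty_test_fun[OF \<alpha>, of A] C0_infty_test_fun[OF \<alpha>, of B] by simp_all
  from integral_partial_swap[OF this i j]
  show "cinner n (blade A * c) (blade B * d) *
      (LINT x|pleb n. partial i (\<lambda>y. coef (\<alpha> y) A) x * partial j (\<lambda>y. coef (\<alpha> y) B) x)
    = cinner n (blade A * c) (blade B * d) *
      (LINT x|pleb n. partial j (\<lambda>y. coef (\<alpha> y) A) x * partial i (\<lambda>y. coef (\<alpha> y) B) x)"
    by simp
qed

text \<open>
  The cross terms cancel: exchanging \<open>i\<close> and \<open>j\<close> in the algebra factors flips the sign, while
  exchanging the derivatives does not change the integral.
\<close>

lemma integral_cinner_Dbar_right:
  assumes \<alpha>: "\<alpha> \<in> C0_infty n U"
  shows "(LINT x|pleb n. cinner n (Dbar_right n \<alpha> x) (Dbar_right n \<alpha> x))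
    = (\<Sum>i\<in>{..n}. LINT x|pleb n. cinner n (cliff_partial n i \<alpha> x) (cliff_partial n i \<alpha> x))"
proof -
  define S where "S i j = (LINT x|pleb n. cinner n (cliff_partial n i \<alpha> x * gen i) (cliff_partial n j \<alpha> x * gen j))" for i j
  define N where "N i j = (if i = j then 0 else S i j)" for i j
  have anti: "S i j = - S j i" if "i \<le> n" "j \<le> n" "i \<noteq> j" for i j
  proof -
    have "S i j = (LINT x|pleb n. - cinner n (cliff_partial n i \<alpha> x * gen j) (cliff_partial n j \<alpha> x * gen i))"
      unfolding S_def by (simp add: cinner_mult_gen_swap[OF cliff_partial_in_Cl cliff_partial_in_Cl that])
    also have "\<dots> = - S j i"
      unfolding S_def using integral_cinner_cliff_partial_swap[OF \<alpha> that(1,2), of "gen j" "gen i"] by simp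
    finally show ?thesis .
  qed
  \<comment> \<open>The off-diagonal part is antisymmetric, so its double sum equals its own
    negative.\<close>
  have "(\<Sum>i\<in>{..n}. \<Sum>j\<in>{..n}. N i j) = (\<Sum>i\<in>{..n}. \<Sum>j\<in>{..n}. - N j i)"
  proof (intro sum.cong refl)
    fix i j assume "i \<in> {..n}" "j \<in> {..n}"
    then show "N i j = - N j i" using anti[of i j] by (simp add: N_def)
  qed
  also have "\<dots> = - (\<Sum>i\<in>{..n}. \<Sum>j\<in>{..n}. N i j)"
    by (subst sum.swap) (simp add: sum_negf)
  finally have N0: "(\<Sum>i\<in>{..n}. \<Sum>j\<in>{..n}. N i j) = 0" by simp
  have "(LINT x|pleb n. cinner n (Dbar_right n \<alpha> x) (Dbar_right n \<alpha> x))
      = (LINT x|pleb n. (\<Sum>i\<in>{..n}. \<Sum>j\<in>{..n}. cinner n (cliff_partial n i \<alpha> x * gen i) (cliff_partial n j \<alpha> x * gen j)))"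
    unfolding Dbar_right_eq_sum_cliff_partial unfolding cinner_sum_left unfolding cinner_sum_right ..
  also have "\<dots> = (\<Sum>i\<in>{..n}. \<Sum>j\<in>{..n}. S i j)"
    unfolding S_def by (intro integral_sum_sum integrable_cinner_cliff_partial[OF \<alpha>]) auto
  also have "\<dots> = (\<Sum>i\<in>{..n}. \<Sum>j\<in>{..n}. (if i = j then S i i else 0) + N i j)"
    by (intro sum.cong refl) (auto simp: N_def)
  also have "\<dots> = (\<Sum>i\<in>{..n}. S i i)"
    by (simp add: sum.distrib N0)
  also have "\<dots> = (\<Sum>i\<in>{..n}. LINT x|pleb n. cinner n (cliff_partial n i \<alpha> x) (cliff_partial n i \<alpha> x))"
    unfolding S_def by (intro sum.cong refl) (simp add: cinner_mult_gen_same cliff_partial_in_Cl)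
  finally show ?thesis .
qed

lemma cinner_ge_0: "0 \<le> cinner n a a"
  by (auto simp: cinner_def intro: sum_nonneg)

lemma L2_bound_Dbar_right:
  assumes \<alpha>: "\<alpha> \<in> C0_infty n (Omega0_int n a b)"
  shows "(LINT x|pleb n. cinner n (\<alpha> x) (\<alpha> x))
    \<le> 4 * (b - a)\<^sup>2 * (LINT x|pleb n. cinner n (Dbar_right n \<alpha> x) (Dbar_right n \<alpha> x))"
proof -
  let ?U = "Omega0_int n a b"
  have t: "test_fun n ?U (\<lambda>y. coef (\<alpha> y) A)" "test_fun n ?U (partial 0 (\<lambda>y. coef (\<alpha> y) A))"
    if "A \<in> Pow {1..n}" for A
    using that C0_infty_test_fun[OF \<alpha>, of A] test_fun_partial[of n ?U _ 0] by auto
  have "(LINT x|pleb n. cinner n (\<alpha> x) (\<alpha> x)) = (\<Sum>A\<in>Pow {1..n}. LINT x|pleb n. (coef (\<alpha> x) A)\<^sup>2)"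
    unfolding cinner_def power2_eq_square
    by (rule Bochner_Integration.integral_sum) (intro test_fun_mult_integrable[where U = ?U] t)
  also have "\<dots> \<le> (\<Sum>A\<in>Pow {1..n}.
      4 * (b - a)\<^sup>2 * (LINT x|pleb n. (partial 0 (\<lambda>y. coef (\<alpha> y) A) x)\<^sup>2))"
    by (intro sum_mono integral_poincare t)
  also have "\<dots> = 4 * (b - a)\<^sup>2 * (LINT x|pleb n. cinner n (cliff_partial n 0 \<alpha> x) (cliff_partial n 0 \<alpha> x))"
  proof -
    have "(LINT x|pleb n. cinner n (cliff_partial n 0 \<alpha> x) (cliff_partial n 0 \<alpha> x))
        = (LINT x|pleb n. (\<Sum>A\<in>Pow {1..n}. partial 0 (\<lambda>y. coef (\<alpha> y) A) x * partial 0 (\<lambda>y. coef (\<alpha> y) A) x))"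
      unfolding cinner_def by (intro Bochner_Integration.integral_cong sum.cong refl) (simp add: coef_cliff_partial)
    also have "\<dots> = (\<Sum>A\<in>Pow {1..n}. LINT x|pleb n. (partial 0 (\<lambda>y. coef (\<alpha> y) A) x)\<^sup>2)"
      unfolding power2_eq_square
      by (rule Bochner_Integration.integral_sum) (intro test_fun_mult_integrable[where U = ?U] t)
    finally show ?thesis by (simp add: sum_distrib_left)
  qed
  also have "\<dots> \<le> 4 * (b - a)\<^sup>2 * (\<Sum>i\<in>{..n}. LINT x|pleb n. cinner n (cliff_partial n i \<alpha> x) (cliff_partial n i \<alpha> x))"
  proof (rule mult_left_mono)
    show "(LINT x|pleb n. cinner n (cliff_partial n 0 \<alpha> x) (cliff_partial n 0 \<alpha> x))
        \<le> (\<Sum>i\<in>{..n}. LINT x|pleb n. cinner n (cliff_partial n i \<alpha> x) (cliff_partial n i \<alpha> x))"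
      by (rule member_le_sum) (auto intro!: Bochner_Integration.integral_nonneg cinner_ge_0)
  qed simp
  finally show ?thesis unfolding integral_cinner_Dbar_right[OF \<alpha>] .
qed

section \<open>The weak solution\<close>

lemma space_leb: "space (leb n) = Rn1 n"
  by (simp add: leb_def space_pleb)

lemma test_fun_square_integrable:
  assumes "test_fun n U g"
  shows "square_integrable (leb n) g"
proof -
  have m: "g \<in> borel_measurable (pleb n)"
    by (rule continuous_borel_measurable_pleb[OF test_fun_continuous[OF assms]])
  then show ?thesis
    using test_fun_mult_integrable[OF assms assms] unfolding square_integrable_def leb_def power2_eq_square
    by (simp add: measurable_completion integrable_completion)
qed

text \<open>Bridge between the Riesz argument, which runs in coordinates over \<open>leb\<close>,
  and the energy estimate, which runs over \<open>pleb\<close>.\<close>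

lemma L2_inner_coef:
  assumes "\<And>A. A \<subseteq> {1..n} \<Longrightarrow> test_fun n U (\<lambda>x. coef (g x) A)"
  shows "L2_inner (leb n) (Pow {1..n}) (\<lambda>A x. coef (g x) A) (\<lambda>A x. coef (g x) A)
    = (LINT x|pleb n. cinner n (g x) (g x))"
proof -
  have "(LINT x|leb n. coef (g x) A * coef (g x) A) = (LINT x|pleb n. coef (g x) A * coef (g x) A)"
    if "A \<in> Pow {1..n}" for A
    unfolding leb_def using that
    by (intro integral_completion borel_measurable_times continuous_borel_measurable_pleb
        test_fun_continuous[OF assms]) auto
  moreover have "(LINT x|pleb n. cinner n (g x) (g x))
      = (\<Sum>A\<in>Pow {1..n}. LINT x|pleb n. coef (g x) A * coef (g x) A)"
    unfolding cinner_def
    by (rule Bochner_Integration.integral_sum) (intro test_fun_mult_integrable[where U = U] assms; simp)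
  ultimately show ?thesis by (simp add: L2_inner_def)
qed

text \<open>Only equal basis elements multiply to a scalar, and the square of
  \<open>e\<^sub>A\<close> is \<open>cliff_sign A A\<close>.\<close>

lemma coef_mult_empty:
  assumes "a \<in> Cl n"
  shows "coef (a * b) {} = (\<Sum>A\<in>Pow {1..n}. cliff_sign A A * (coef a A * coef b A))"
  by (simp add: coef_mult[OF assms])

text \<open>Since the square of \<open>e\<^sub>C\<close> is \<open>cliff_sign C C\<close>,
  multiplying by \<open>e\<^sub>C\<close> brings coefficient \<open>C\<close> to the scalar position
  with that sign. This reduces the weak equation to scalar parts.\<close>

lemma coef_mult_eq_coef_empty:
  assumes "C \<subseteq> {1..n}"
  shows "coef (a * b) C = cliff_sign C C * coef (blade C * a * b) {}"
proof -
  have "coef (blade C * (a * b)) {} = cliff_sign C C * coef (a * b) C"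
    using coef_blade_mult[OF assms, of "a * b" "{}"] by simp
  then show ?thesis
    by (simp add: mult.assoc mult.assoc[of "cliff_sign C C" "cliff_sign C C" for C, symmetric]
        cliff_sign_square)
qed

lemma Omega0_int_sets: "Omega0_int n a b \<in> sets (leb n)"
  and Omega0_sets: "Omega0 n a b \<in> sets (leb n)"
proof -
  have [measurable]: "(\<lambda>x. x 0) \<in> borel_measurable (leb n)"
    unfolding leb_def
    using measurable_component_singleton[of 0 "{..n}" "\<lambda>_. lborel :: real measure"]
    by (intro measurable_completion) simp
  have "{x \<in> space (leb n). a < x 0 \<and> x 0 < b} \<in> sets (leb n)" by measurable
  then show "Omega0_int n a b \<in> sets (leb n)" by (simp add: Omega0_int_def space_leb)
  have "{x \<in> space (leb n). a \<le> x 0 \<and> x 0 \<le> b} \<in> sets (leb n)" by measurable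
  then show "Omega0 n a b \<in> sets (leb n)" by (simp add: Omega0_def space_leb)
qed

lemma Omega0_int_subset: "Omega0_int n a b \<subseteq> Omega0 n a b"
  by (auto simp: Omega0_int_def Omega0_def)

lemma weak_solution_exists:
  assumes f: "f \<in> L2 n (Omega0 n a b)"
  shows "\<exists>u \<in> L2 n (Omega0 n a b). weak_solution n (Omega0_int n a b) u f \<and>
    (LINT x:Omega0 n a b|leb n. (norm0 n (u x))\<^sup>2)
      \<le> 4 * (b - a)\<^sup>2 * (LINT x:Omega0 n a b|leb n. (norm0 n (f x))\<^sup>2)"
proof -
  let ?U = "Omega0_int n a b" and ?O = "Omega0 n a b" and ?I = "Pow {1..n}" and ?M = "leb n"
  \<comment> \<open>The sign turns the Euclidean pairing of \<open>\<alpha>\<close> with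
    \<open>F\<close> into the scalar part of \<open>\<alpha> x * f x\<close>; the indicator
    restricts it to the open strip, where the weak equation is tested.\<close>
  define F where "F A x = indicator ?U x * (cliff_sign A A * coef (f x) A)" for A x
  define T where "T \<alpha> A x = coef (Dbar_right n \<alpha> x) A" for \<alpha> A x
  define l where "l \<alpha> = L2_inner ?M ?I (\<lambda>A x. coef (\<alpha> x) A) F" for \<alpha>
  define K where "K = 4 * (b - a)\<^sup>2 * L2_inner ?M ?I F F"
  have sign_sq: "cliff_sign A A * (cliff_sign A A * r) = r" for A r
    by (simp add: mult.assoc[symmetric] cliff_sign_square)
  have fm: "(\<lambda>x. indicator ?O x * coef (f x) A) \<in> borel_measurable ?M"
    and fi: "integrable ?M (\<lambda>x. indicator ?O x * (coef (f x) A)\<^sup>2)" if "A \<in> ?I" for A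
    using f that by (auto simp: L2_def set_borel_measurable_def set_integrable_def)
  \<comment> \<open>Measurability of \<open>f\<close> is given only on the closed strip, so the
    cut-off is routed through \<open>Omega0\<close>.\<close>
  have F_eq: "F A x = cliff_sign A A * (indicator ?U x * (indicator ?O x * coef (f x) A))" for A x
    using Omega0_int_subset[of n a b] by (auto simp: F_def indicator_def)
  have F2: "(F A x)\<^sup>2 = indicator ?U x * (indicator ?O x * (coef (f x) A)\<^sup>2)" for A x
    using Omega0_int_subset[of n a b] sign_sq[of A]
    by (auto simp: F_def indicator_def power2_eq_square mult_ac)
  have Fi: "integrable ?M (\<lambda>x. (F A x)\<^sup>2)" if "A \<in> ?I" for A
    unfolding F2
    using integrable_mult_indicator[OF Omega0_int_sets fi[OF that], of a b] by simp
  have F: "L2_family ?M ?I F"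
    unfolding L2_family_def square_integrable_def
  proof (intro ballI conjI Fi)
    fix A assume A: "A \<in> ?I"
    show "F A \<in> borel_measurable ?M"
      unfolding F_eq[abs_def]
      by (rule borel_measurable_times[OF borel_measurable_const
            borel_measurable_times[OF borel_measurable_indicator[OF Omega0_int_sets] fm[OF A]]])
  qed
  have c: "L2_family ?M ?I (\<lambda>A x. coef (\<alpha> x) A)" if "\<alpha> \<in> C0_infty n ?U" for \<alpha>
    unfolding L2_family_def using C0_infty_test_fun[OF that] by (auto intro: test_fun_square_integrable)
  have T: "L2_family ?M ?I (T \<alpha>)" if "\<alpha> \<in> C0_infty n ?U" for \<alpha>
    unfolding L2_family_def T_def
    using test_fun_square_integrable[OF test_fun_coef_Dbar_right[OF that]] by blast
  have K0: "0 \<le> K" by (simp add: K_def L2_inner_ge_0)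
  have "\<exists>w. L2_family ?M ?I w \<and> (\<forall>\<alpha>\<in>C0_infty n ?U. l \<alpha> = L2_inner ?M ?I w (T \<alpha>)) \<and>
      L2_inner ?M ?I w w \<le> K"
  proof (rule L2_riesz)
    have "(\<lambda>_. 0) \<in> C0_infty n ?U"
      by (auto simp: C0_infty_iff test_fun_zero Cl_def)
    then show "C0_infty n ?U \<noteq> {}" by blast
    show "\<exists>\<gamma>\<in>C0_infty n ?U. l \<gamma> = s * l \<alpha> + t * l \<beta> \<and>
        (\<forall>A\<in>?I. \<forall>x\<in>space ?M. T \<gamma> A x = s * T \<alpha> A x + t * T \<beta> A x)"
      if \<alpha>\<beta>: "\<alpha> \<in> C0_infty n ?U" "\<beta> \<in> C0_infty n ?U" for \<alpha> \<beta> s t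
    proof (intro bexI conjI ballI)
      show "(\<lambda>x. s *\<^sub>R \<alpha> x + t *\<^sub>R \<beta> x) \<in> C0_infty n ?U" by (rule C0_infty_lincomb[OF \<alpha>\<beta>])
      show "l (\<lambda>x. s *\<^sub>R \<alpha> x + t *\<^sub>R \<beta> x) = s * l \<alpha> + t * l \<beta>"
        using L2_inner_lincomb_left[OF c[OF \<alpha>\<beta>(1)] c[OF \<alpha>\<beta>(2)] F, of s t] by (simp add: l_def)
      show "T (\<lambda>x. s *\<^sub>R \<alpha> x + t *\<^sub>R \<beta> x) A x = s * T \<alpha> A x + t * T \<beta> A x" if "x \<in> space ?M" for A x
        using Dbar_right_lincomb[OF \<alpha>\<beta>, of x s t] that by (simp add: T_def space_leb)
    qed
    show "(l \<alpha>)\<^sup>2 \<le> K * L2_inner ?M ?I (T \<alpha>) (T \<alpha>)" if \<alpha>: "\<alpha> \<in> C0_infty n ?U" for \<alpha>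
    proof -
      have "(l \<alpha>)\<^sup>2 \<le> L2_inner ?M ?I (\<lambda>A x. coef (\<alpha> x) A) (\<lambda>A x. coef (\<alpha> x) A) * L2_inner ?M ?I F F"
        unfolding l_def by (rule L2_Cauchy_Schwarz[OF c[OF \<alpha>] F])
      also have "\<dots> \<le> (4 * (b - a)\<^sup>2 * L2_inner ?M ?I (T \<alpha>) (T \<alpha>)) * L2_inner ?M ?I F F"
      proof (rule mult_right_mono[OF _ L2_inner_ge_0])
        show "L2_inner ?M ?I (\<lambda>A x. coef (\<alpha> x) A) (\<lambda>A x. coef (\<alpha> x) A)
            \<le> 4 * (b - a)\<^sup>2 * L2_inner ?M ?I (T \<alpha>) (T \<alpha>)"
          using L2_bound_Dbar_right[OF \<alpha>] L2_inner_coef[of n ?U \<alpha>]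
            L2_inner_coef[of n ?U "Dbar_right n \<alpha>"] C0_infty_test_fun[OF \<alpha>]
            test_fun_coef_Dbar_right[OF \<alpha>]
          by (simp add: T_def[abs_def])
      qed
      finally show ?thesis by (simp add: K_def mult_ac)
    qed
  qed (use T K0 in auto)
  then obtain w where w: "L2_family ?M ?I w" and wl: "\<And>\<alpha>. \<alpha> \<in> C0_infty n ?U \<Longrightarrow> l \<alpha> = L2_inner ?M ?I w (T \<alpha>)"
    and wK: "L2_inner ?M ?I w w \<le> K" by blast
  \<comment> \<open>\<open>w\<close> is defined on all of \<open>Rn1 n\<close>, hence the cut-off.
    The factor \<open>cliff_sign A A\<close> cancels the sign in the scalar part of a product, and
    the minus is the one in the weak equation.\<close>
  define u where "u x = (\<Sum>A\<in>?I. (indicator ?U x * (- cliff_sign A A * w A x)) *\<^sub>R blade A)" for x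
  have u_Cl: "u x \<in> Cl n" for x unfolding u_def by (rule blade_sum_in_Cl)
  have coef_u: "coef (u x) A = indicator ?U x * (- cliff_sign A A * w A x)" if "A \<in> ?I" for A x
    unfolding u_def using that by (intro coef_blade_sum) simp
  have u2: "indicator ?O x * (coef (u x) A)\<^sup>2 = indicator ?U x * (w A x)\<^sup>2" if "A \<in> ?I" for A x
    unfolding coef_u[OF that] using Omega0_int_subset[of n a b] sign_sq[of A]
    by (auto simp: indicator_def power2_eq_square mult_ac)
  have wi: "integrable ?M (\<lambda>x. (w A x)\<^sup>2)" "w A \<in> borel_measurable ?M" if "A \<in> ?I" for A
    using w that by (auto simp: L2_family_def square_integrable_def)
  have wUi: "integrable ?M (\<lambda>x. indicator ?U x * (w A x)\<^sup>2)" if "A \<in> ?I" for A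
    using integrable_mult_indicator[OF Omega0_int_sets wi(1)[OF that], of a b] by simp
  have u_L2: "u \<in> L2 n ?O"
    unfolding L2_def
  proof (intro CollectI conjI ballI u_Cl)
    fix A assume A: "A \<in> ?I"
    show "set_integrable ?M ?O (\<lambda>x. (coef (u x) A)\<^sup>2)"
      unfolding set_integrable_def using wUi[OF A] by (simp add: u2[OF A])
    show "set_borel_measurable ?M ?O (\<lambda>x. coef (u x) A)"
      unfolding set_borel_measurable_def real_scaleR_def coef_u[OF A]
      by (intro borel_measurable_times borel_measurable_const borel_measurable_indicator wi A
          Omega0_int_sets Omega0_sets)
  qed
  have "weak_solution n ?U u f"
    unfolding weak_solution_def
  proof
    fix \<alpha> assume \<alpha>: "\<alpha> \<in> C0_infty n ?U"
    have "(LINT x:?U|?M. coef (\<alpha> x * f x) C) = - (LINT x:?U|?M. coef (Dbar_right n \<alpha> x * u x) C)"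
      if C: "C \<in> ?I" for C
    proof -
      define \<beta> where "\<beta> x = blade C * \<alpha> x" for x
      have C': "C \<subseteq> {1..n}" using C by simp
      have \<beta>: "\<beta> \<in> C0_infty n ?U"
        unfolding \<beta>_def[abs_def] by (rule C0_infty_blade_mult[OF \<alpha> C'])
      have "(LINT x:?U|?M. coef (\<alpha> x * f x) C)
          = (LINT x|?M. (\<Sum>A\<in>?I. cliff_sign C C * (coef (\<beta> x) A * F A x)))"
        unfolding set_lebesgue_integral_def
      proof (rule Bochner_Integration.integral_cong[OF refl])
        fix x assume "x \<in> space ?M"
        then have "\<beta> x \<in> Cl n" using \<beta> by (simp add: C0_infty_iff space_leb)
        from coef_mult_empty[OF this, of "f x"]
        show "indicator ?U x *\<^sub>R coef (\<alpha> x * f x) C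
            = (\<Sum>A\<in>?I. cliff_sign C C * (coef (\<beta> x) A * F A x))"
          unfolding coef_mult_eq_coef_empty[OF C'] \<beta>_def[symmetric] F_def
          by (simp add: sum_distrib_left mult_ac)
      qed
      also have "\<dots> = cliff_sign C C * l \<beta>"
        unfolding l_def L2_inner_def sum_distrib_left
        using c[OF \<beta>] F
        by (subst Bochner_Integration.integral_sum)
          (auto simp: L2_family_def intro!: square_integrable_mult)
      also have "l \<beta> = L2_inner ?M ?I w (T \<beta>)" by (rule wl[OF \<beta>])
      also have "cliff_sign C C * \<dots> = (LINT x|?M. (\<Sum>A\<in>?I. cliff_sign C C * (w A x * T \<beta> A x)))"
        unfolding L2_inner_def sum_distrib_left
        using T[OF \<beta>] w
        by (subst Bochner_Integration.integral_sum)
          (auto simp: L2_family_def intro!: square_integrable_mult)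
      also have "\<dots> = (LINT x:?U|?M. - coef (Dbar_right n \<alpha> x * u x) C)"
        unfolding set_lebesgue_integral_def
      proof (rule Bochner_Integration.integral_cong[OF refl])
        fix x assume "x \<in> space ?M"
        then have x: "x \<in> Rn1 n" by (simp add: space_leb)
        have D: "blade C * Dbar_right n \<alpha> x = Dbar_right n \<beta> x"
          unfolding \<beta>_def[abs_def] by (rule Dbar_right_blade_mult[OF \<alpha> C' x, symmetric])
        have "coef (Dbar_right n \<beta> x * u x) {}
            = (\<Sum>A\<in>?I. cliff_sign A A * (T \<beta> A x * coef (u x) A))"
          unfolding T_def by (rule coef_mult_empty[OF Dbar_right_in_Cl])
        also have "\<dots> = (\<Sum>A\<in>?I. - (indicator ?U x * (w A x * T \<beta> A x)))"
          by (intro sum.cong refl) (simp add: coef_u sign_sq mult_ac)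
        \<comment> \<open>The cut-off in \<open>u\<close> is invisible here:
          \<open>T \<beta>\<close> vanishes off the open strip. So the pairing with \<open>w\<close>
          over the whole space becomes an integral over the strip.\<close>
        also have "\<dots> = (\<Sum>A\<in>?I. - (w A x * T \<beta> A x))"
        proof (intro sum.cong refl)
          fix A
          have "x \<notin> ?U \<Longrightarrow> T \<beta> A x = 0"
            unfolding T_def by (rule test_fun_zero_outside[OF test_fun_coef_Dbar_right[OF \<beta>] x])
          then show "- (indicator ?U x * (w A x * T \<beta> A x)) = - (w A x * T \<beta> A x)"
            by (cases "x \<in> ?U") auto
        qed
        finally have e: "coef (Dbar_right n \<alpha> x * u x) C
            = - (\<Sum>A\<in>?I. cliff_sign C C * (w A x * T \<beta> A x))"
          unfolding coef_mult_eq_coef_empty[OF C'] D by (simp add: sum_negf sum_distrib_left)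
        have "x \<notin> ?U \<Longrightarrow> (\<Sum>A\<in>?I. cliff_sign C C * (w A x * T \<beta> A x)) = 0"
          unfolding T_def by (simp add: test_fun_zero_outside[OF test_fun_coef_Dbar_right[OF \<beta>] x])
        then show "(\<Sum>A\<in>?I. cliff_sign C C * (w A x * T \<beta> A x))
            = indicator ?U x *\<^sub>R - coef (Dbar_right n \<alpha> x * u x) C"
          unfolding e by (cases "x \<in> ?U") auto
      qed
      finally show ?thesis by (simp add: set_lebesgue_integral_def)
    qed
    then show "cliff_integral n ?U (\<lambda>x. \<alpha> x * f x) = - cliff_integral n ?U (\<lambda>x. Dbar_right n \<alpha> x * u x)"
      unfolding cliff_integral_def by (simp add: sum_negf)
  qed
  moreover have "(LINT x:?O|?M. (norm0 n (u x))\<^sup>2) \<le> 4 * (b - a)\<^sup>2 * (LINT x:?O|?M. (norm0 n (f x))\<^sup>2)"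
  proof -
    have norm_int: "(LINT x:?O|?M. (norm0 n (g x))\<^sup>2) = 2 ^ n * (\<Sum>A\<in>?I. LINT x|?M. indicator ?O x * (coef (g x) A)\<^sup>2)"
      if "\<And>A. A \<in> ?I \<Longrightarrow> integrable ?M (\<lambda>x. indicator ?O x * (coef (g x) A)\<^sup>2)" for g :: "(nat \<Rightarrow> real) \<Rightarrow> cliff"
    proof -
      have "(LINT x:?O|?M. (norm0 n (g x))\<^sup>2)
          = (LINT x|?M. 2 ^ n * (\<Sum>A\<in>?I. indicator ?O x * (coef (g x) A)\<^sup>2))"
        by (simp only: set_lebesgue_integral_def norm0_square real_scaleR_def
            sum_distrib_left[symmetric] mult.left_commute)
      also have "\<dots> = 2 ^ n * (LINT x|?M. (\<Sum>A\<in>?I. indicator ?O x * (coef (g x) A)\<^sup>2))"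
        by (rule integral_mult_right_zero)
      also have "(LINT x|?M. (\<Sum>A\<in>?I. indicator ?O x * (coef (g x) A)\<^sup>2))
          = (\<Sum>A\<in>?I. LINT x|?M. indicator ?O x * (coef (g x) A)\<^sup>2)"
        by (rule Bochner_Integration.integral_sum[OF that])
      finally show ?thesis .
    qed
    have le: "indicator S x * r \<le> r" if "0 \<le> r" for S :: "(nat \<Rightarrow> real) set" and x and r :: real
      using that by (cases "x \<in> S") auto
    have "(\<Sum>A\<in>?I. LINT x|?M. indicator ?O x * (coef (u x) A)\<^sup>2)
        \<le> (\<Sum>A\<in>?I. LINT x|?M. w A x * w A x)"
      unfolding power2_eq_square[of "w _ _", symmetric]
      by (intro sum_mono integral_mono wi) (simp_all add: u2 wUi le)
    also have "\<dots> \<le> 4 * (b - a)\<^sup>2 * (\<Sum>A\<in>?I. LINT x|?M. F A x * F A x)"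
      using wK unfolding K_def L2_inner_def .
    also have "\<dots> \<le> 4 * (b - a)\<^sup>2 * (\<Sum>A\<in>?I. LINT x|?M. indicator ?O x * (coef (f x) A)\<^sup>2)"
    proof (rule mult_left_mono)
      show "(\<Sum>A\<in>?I. LINT x|?M. F A x * F A x)
          \<le> (\<Sum>A\<in>?I. LINT x|?M. indicator ?O x * (coef (f x) A)\<^sup>2)"
        unfolding power2_eq_square[of "F _ _", symmetric]
        by (intro sum_mono integral_mono Fi fi) (simp_all add: F2 le)
    qed simp
    finally have "2 ^ n * (\<Sum>A\<in>?I. LINT x|?M. indicator ?O x * (coef (u x) A)\<^sup>2)
        \<le> 2 ^ n * (4 * (b - a)\<^sup>2 * (\<Sum>A\<in>?I. LINT x|?M. indicator ?O x * (coef (f x) A)\<^sup>2))"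
      by (rule mult_left_mono) simp
    moreover have "integrable ?M (\<lambda>x. indicator ?O x * (coef (u x) A)\<^sup>2)" if "A \<in> ?I" for A
      using wUi[OF that] by (simp only: u2[OF that])
    ultimately show ?thesis
      by (simp only: norm_int[OF fi] norm_int[of u] mult.left_commute[of "2 ^ n"])
  qed
  ultimately show ?thesis using u_L2 by blast
qed

theorem theorem1p6:
  shows "\<exists>c :: real \<Rightarrow> real \<Rightarrow> real. \<forall>n\<ge>1. \<forall>a b. a < b \<longrightarrow>
    (\<forall>f \<in> L2 n (Omega0 n a b). \<exists>u \<in> L2 n (Omega0 n a b).
       weak_solution n (Omega0_int n a b) u f \<and>
       (LINT x:Omega0 n a b|leb n. (norm0 n (u x))\<^sup>2)
         \<le> 2 ^ (2 * n) * c a b * (LINT x:Omega0 n a b|leb n. (norm0 n (f x))\<^sup>2))"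
\<comment> \<open>The witness is chosen before \<open>n\<close>, so it is the Poincare constant of
  the interval in the \<open>x 0\<close> direction.\<close>
proof (intro exI[of _ "\<lambda>a b. 4 * (b - a)\<^sup>2"] allI impI ballI)
  fix n :: nat and a b :: real and f
  assume "f \<in> L2 n (Omega0 n a b)"
  then obtain u where u: "u \<in> L2 n (Omega0 n a b)" "weak_solution n (Omega0_int n a b) u f"
    "(LINT x:Omega0 n a b|leb n. (norm0 n (u x))\<^sup>2)
      \<le> 4 * (b - a)\<^sup>2 * (LINT x:Omega0 n a b|leb n. (norm0 n (f x))\<^sup>2)"
    using weak_solution_exists by blast
  let ?N = "4 * (b - a)\<^sup>2 * (LINT x:Omega0 n a b|leb n. (norm0 n (f x))\<^sup>2)"
  have "0 \<le> ?N"
    unfolding set_lebesgue_integral_def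
    by (intro mult_nonneg_nonneg Bochner_Integration.integral_nonneg) auto
  \<comment> \<open>The bound has a nonnegative right-hand side, so the factor
    \<open>2 ^ (2 * n) \<ge> 1\<close> only enlarges it.\<close>
  then have "1 * ?N \<le> 2 ^ (2 * n) * ?N" by (intro mult_right_mono) auto
  with u(3) have "(LINT x:Omega0 n a b|leb n. (norm0 n (u x))\<^sup>2)
      \<le> 2 ^ (2 * n) * (4 * (b - a)\<^sup>2) * (LINT x:Omega0 n a b|leb n. (norm0 n (f x))\<^sup>2)"
    by (simp only: mult.assoc mult_1)
  with u show "\<exists>u \<in> L2 n (Omega0 n a b). weak_solution n (Omega0_int n a b) u f \<and>
      (LINT x:Omega0 n a b|leb n. (norm0 n (u x))\<^sup>2)
        \<le> 2 ^ (2 * n) * (4 * (b - a)\<^sup>2) * (LINT x:Omega0 n a b|leb n. (norm0 n (f x))\<^sup>2)"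
    by blast
qed

end
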